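(* For $i=0,1$, the set $$\widehat{\mathfrak{B}}_{W(\Lambda_i)}=\big\{\widehat{x}(l_m)\cdots\widehat{x}(l_2)\widehat{x}(l_1)v_{\Lambda_i}\;:\; m\in\mathbb{Z}_{\ge0},\ l_1,\dots,l_m\in\mathbb{Z},\ l_1\le-1-\delta_{1i},\ l_{r+1}\le l_r-2\text{ for }r=1,\dots,m-1\big\}$$ forms a basis for the principal subspace $W(\Lambda_i)$.
   Context: Let $q$ be an indeterminate, $F=\mathbb{C}(q^{1/2})$, $[m]=\frac{q^m-q^{-m}}{q-q^{-1}}$. Let $K(1)=F[a(-1),a(-2),\dots]$ be the polynomial algebra on which $a(-r)$ ($r\ge1$) acts by multiplication and $a(r)$ ($r\ge1$) acts as the derivation with $a(r)\cdot a(-s)=\delta_{rs}\frac{[2r][r]}{r}$. Let $P=\mathbb{Z}\lambda\supset Q=\mathbb{Z}\alpha$, $\lambda=\alpha/2$, $(\alpha,\alpha)=2$; $F\{P\}$ is the group algebra with basis $e^\mu$, $\mu\in P$; $L=K(1)\otimes F\{P\}=L_0\oplus L_1$ with $L_0=K(1)\otimes F\{Q\}$, $L_1=K(1)\otimes F\{Q\}e^\lambda$; $z^{\partial_\alpha}e^\beta=z^{(\alpha,\beta)}e^\beta$. The Frenkel–Jing operator is $$x^+(z)=\sum_{r\in\mathbb{Z}}x^+(r)z^{-r-1}=\exp\Big(\sum_{r\ge1}\tfrac{q^{-r/2}}{[r]}a(-r)z^r\Big)\exp\Big(-\sum_{r\ge1}\tfrac{q^{-r/2}}{[r]}a(r)z^{-r}\Big)\otimes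 e^\alpha z^{\partial_\alpha}.$$ By Frenkel–Jing, $L_i$ ($i=0,1$) is the level one integrable highest weight $U_q(\widehat{\mathfrak{sl}}_2)$-module $L(\Lambda_i)$, $x^+(r)$ being the action of the Drinfeld generators, with highest weight vectors $v_{\Lambda_0}=1\otimes1$, $v_{\Lambda_1}=1\otimes e^\lambda$. The principal subspace is $W(\Lambda_i)=U_q(\widehat{\mathfrak n}^+)v_{\Lambda_i}$, where $U_q(\widehat{\mathfrak n}^+)$ is the subalgebra generated by all $x^+(r)$, $r\in\mathbb{Z}$. Finally $$\widehat{k}(z)=\exp\Big((q-q^{-1})\sum_{r\ge1}\tfrac{-q^{r/2}}{1+q^{2r}}a(r)z^{-r}\Big),\qquad \widehat{x}(z)=x^+(z)\widehat{k}(z)=\sum_{r\in\mathbb{Z}}\widehat{x}(r)z^{-r-1}\in\mathrm{Hom}(L,L((z))).$$ *)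

theory Defs
  imports
    "HOL-Computational_Algebra.Computational_Algebra"
    "HOL-Library.Poly_Mapping"
begin

text \<open>
  The ground field \<open>F = \<complex>(q\<^sup>1\<^sup>/\<^sup>2)\<close>: rational functions in the indeterminate \<open>qh = q\<^sup>1\<^sup>/\<^sup>2\<close>.
\<close>

type_synonym qfield = "complex poly fract"

definition qh :: qfield where
  "qh = Fract [:0, 1:] 1"

definition qq :: qfield where
  "qq = qh ^ 2"

definition qint :: "int \<Rightarrow> qfield" where
  "qint m = (qq powi m - qq powi (- m)) / (qq - inverse qq)"

text \<open>
  \<open>K(1)\<close> is the polynomial algebra over \<open>F\<close> whose variable number \<open>j = 0, 1, 2, \<dots>\<close> is
  \<open>a(-(j+1))\<close>; monomials are exponent vectors. \<open>L = K(1) \<otimes> F{P}\<close> is the group algebra of \<open>P = \<int>\<lambda>\<close>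
  over \<open>K(1)\<close>, with \<open>n :: int\<close> standing for \<open>n\<lambda>\<close>; its ring multiplication is that of
  \<open>K(1) \<otimes> F{P}\<close>.
\<close>

type_synonym K1 = "(nat \<Rightarrow>\<^sub>0 nat) \<Rightarrow>\<^sub>0 qfield"

type_synonym fock = "int \<Rightarrow>\<^sub>0 K1"

definition embK :: "K1 \<Rightarrow> fock" where
  "embK p = Poly_Mapping.single 0 p"

definition constK :: "qfield \<Rightarrow> K1" where
  "constK c = Poly_Mapping.single 0 c"

definition scaleL :: "qfield \<Rightarrow> fock \<Rightarrow> fock" where
  "scaleL c v = embK (constK c) * v"

definition expP :: "int \<Rightarrow> fock" where
  "expP n = Poly_Mapping.single n 1"

lemma vector_space_scaleL: "vector_space scaleL"
proof
  fix a b :: qfield and x y :: fock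
  show "scaleL a (x + y) = scaleL a x + scaleL a y"
    by (simp add: scaleL_def distrib_left)
  show "scaleL (a + b) x = scaleL a x + scaleL b x"
    by (simp add: scaleL_def embK_def constK_def single_add distrib_right)
  show "scaleL a (scaleL b x) = scaleL (a * b) x"
    by (simp add: scaleL_def embK_def constK_def mult_single flip: mult.assoc)
  show "scaleL 1 x = x"
    by (simp add: scaleL_def embK_def constK_def)
qed

interpretation L: vector_space scaleL
  by (rule vector_space_scaleL)

definition avar :: "nat \<Rightarrow> K1" where
  "avar r = Poly_Mapping.single (Poly_Mapping.single (r - 1) 1) 1"

definition pdiff :: "nat \<Rightarrow> K1 \<Rightarrow> K1" where
  "pdiff j p = (\<Sum>m\<in>Poly_Mapping.keys p.
     Poly_Mapping.single (m - Poly_Mapping.single j 1)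
       (of_nat (Poly_Mapping.lookup m j) * Poly_Mapping.lookup p m))"

text \<open>
  For \<open>r \<ge> 1\<close>, \<open>a_neg r\<close> and \<open>a_pos r\<close> are the actions of \<open>a(-r)\<close> and \<open>a(r)\<close> on \<open>L\<close> (as
  \<open>a(\<plusminus>r) \<otimes> 1\<close>). The lemmas \<open>a_pos_add\<close>, \<open>a_pos_scaleL\<close>, \<open>a_pos_mult\<close>, \<open>a_pos_avar\<close> and \<open>a_pos_expP\<close>
  below show that \<open>a_pos r\<close> is the derivation with
  \<open>a(r) \<cdot> a(-s) = \<delta>\<^sub>r\<^sub>s [2r][r]/r\<close>.
\<close>

definition a_neg :: "nat \<Rightarrow> fock \<Rightarrow> fock" where
  "a_neg r v = embK (avar r) * v"

definition a_coeff :: "nat \<Rightarrow> qfield" where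
  "a_coeff r = qint (2 * int r) * qint (int r) / of_nat r"

definition a_pos :: "nat \<Rightarrow> fock \<Rightarrow> fock" where
  "a_pos r v = Poly_Mapping.map (\<lambda>p. constK (a_coeff r) * pdiff (r - 1) p) v"

lemma lookup_pdiff:
  "Poly_Mapping.lookup (pdiff j p) m =
     of_nat (Poly_Mapping.lookup m j + 1) * Poly_Mapping.lookup p (m + Poly_Mapping.single j 1)"
proof -
  let ?e = "Poly_Mapping.single j (1::nat)"
  have eq: "(of_nat (Poly_Mapping.lookup n j) * Poly_Mapping.lookup p n when n - ?e = m)
      = (if n = m + ?e then of_nat (Poly_Mapping.lookup m j + 1) * Poly_Mapping.lookup p (m + ?e) else 0)"
    for n
  proof (cases "Poly_Mapping.lookup n j = 0")
    case True
    then have "n \<noteq> m + ?e" by (auto simp: lookup_add)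
    with True show ?thesis by simp
  next
    case False
    have "n = (n - ?e) + ?e"
      by (rule poly_mapping_eqI) (use False in \<open>auto simp: lookup_add lookup_minus lookup_single when_def\<close>)
    then have "n - ?e = m \<longleftrightarrow> n = m + ?e" by auto
    then show ?thesis by (auto simp: lookup_add)
  qed
  have "Poly_Mapping.lookup (pdiff j p) m = (\<Sum>n\<in>Poly_Mapping.keys p.
      if n = m + ?e then of_nat (Poly_Mapping.lookup m j + 1) * Poly_Mapping.lookup p (m + ?e) else 0)"
    unfolding pdiff_def lookup_sum lookup_single using eq by simp
  also have "\<dots> = of_nat (Poly_Mapping.lookup m j + 1) * Poly_Mapping.lookup p (m + ?e)"
    by (auto simp: sum.delta in_keys_iff)
  finally show ?thesis .
qed

lemma pdiff_add: "pdiff j (p + p') = pdiff j p + pdiff j p'"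
  by (rule poly_mapping_eqI) (simp add: lookup_pdiff lookup_add algebra_simps)

lemma pdiff_0 [simp]: "pdiff j 0 = 0"
  by (simp add: pdiff_def)

lemma pdiff_single:
  "pdiff j (Poly_Mapping.single m c) =
     Poly_Mapping.single (m - Poly_Mapping.single j 1) (of_nat (Poly_Mapping.lookup m j) * c)"
  by (cases "c = 0") (auto simp: pdiff_def)

lemma poly_mapping_add_induct [case_names zero add]:
  assumes "P 0"
    and "\<And>p k c. P p \<Longrightarrow> P (p + Poly_Mapping.single k c)"
  shows "P p"
proof (induction p rule: Poly_Mapping.update_induct)
  case const
  show ?case by (rule assms)
next
  case (update f a b)
  have "Poly_Mapping.update a b f = f + Poly_Mapping.single a b"
    by (rule poly_mapping_eqI)
      (use update in \<open>auto simp: lookup_update lookup_add lookup_single when_def in_keys_iff\<close>)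
  with update assms(2) show ?case by simp
qed

lemma pdiff_mult_single:
  "pdiff j (Poly_Mapping.single m c * Poly_Mapping.single n d) =
     pdiff j (Poly_Mapping.single m c) * Poly_Mapping.single n d +
     Poly_Mapping.single m c * pdiff j (Poly_Mapping.single n d)"
proof -
  let ?e = "Poly_Mapping.single j (1::nat)"
  have 1: "Poly_Mapping.single (m + n - ?e) (of_nat (Poly_Mapping.lookup m j) * c * d)
     = Poly_Mapping.single (m - ?e + n) (of_nat (Poly_Mapping.lookup m j) * c * d)"
    for m n :: "nat \<Rightarrow>\<^sub>0 nat" and c d :: qfield
  proof (cases "Poly_Mapping.lookup m j = 0")
    case False
    then have "m + n - ?e = m - ?e + n"
      by (intro poly_mapping_eqI) (auto simp: lookup_add lookup_minus lookup_single when_def)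
    then show ?thesis by simp
  qed simp
  have "pdiff j (Poly_Mapping.single m c * Poly_Mapping.single n d) =
      Poly_Mapping.single (m + n - ?e) (of_nat (Poly_Mapping.lookup m j) * c * d) +
      Poly_Mapping.single (n + m - ?e) (of_nat (Poly_Mapping.lookup n j) * d * c)"
    by (simp add: mult_single pdiff_single lookup_add add.commute algebra_simps flip: single_add)
  also have "\<dots> = pdiff j (Poly_Mapping.single m c) * Poly_Mapping.single n d +
     Poly_Mapping.single m c * pdiff j (Poly_Mapping.single n d)"
    unfolding 1 by (simp add: mult_single pdiff_single add.commute mult_ac)
  finally show ?thesis .
qed

lemma pdiff_mult: "pdiff j (p * p') = pdiff j p * p' + p * pdiff j p'"
proof (induction p rule: poly_mapping_add_induct)
  case (add p k c)
  have "pdiff j (Poly_Mapping.single k c * p') =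
      pdiff j (Poly_Mapping.single k c) * p' + Poly_Mapping.single k c * pdiff j p'"
  proof (induction p' rule: poly_mapping_add_induct)
    case (add p' n d)
    then show ?case
      by (simp add: distrib_left pdiff_add pdiff_mult_single algebra_simps)
  qed simp
  with add show ?case
    by (simp add: distrib_right pdiff_add algebra_simps)
qed simp

lemma lookup_a_pos:
  "Poly_Mapping.lookup (a_pos r v) n =
     constK (a_coeff r) * pdiff (r - 1) (Poly_Mapping.lookup v n)"
  unfolding a_pos_def by (simp add: Poly_Mapping.map.rep_eq when_def)

lemma a_pos_0 [simp]: "a_pos r 0 = 0"
  by (rule poly_mapping_eqI) (simp add: lookup_a_pos)

lemma a_pos_add: "a_pos r (v + w) = a_pos r v + a_pos r w"
  by (rule poly_mapping_eqI) (simp add: lookup_a_pos lookup_add pdiff_add distrib_left)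

lemma a_pos_single:
  "a_pos r (Poly_Mapping.single n p) = Poly_Mapping.single n (constK (a_coeff r) * pdiff (r - 1) p)"
  by (rule poly_mapping_eqI) (simp add: lookup_a_pos lookup_single when_def)

lemma a_pos_mult: "a_pos r (v * w) = a_pos r v * w + v * a_pos r w"
proof (induction v rule: poly_mapping_add_induct)
  case (add v k c)
  have "a_pos r (Poly_Mapping.single k c * w) =
      a_pos r (Poly_Mapping.single k c) * w + Poly_Mapping.single k c * a_pos r w"
  proof (induction w rule: poly_mapping_add_induct)
    case (add w n d)
    have "a_pos r (Poly_Mapping.single k c * Poly_Mapping.single n d) =
      a_pos r (Poly_Mapping.single k c) * Poly_Mapping.single n d +
      Poly_Mapping.single k c * a_pos r (Poly_Mapping.single n d)"
      by (simp add: a_pos_single mult_single pdiff_mult algebra_simps flip: single_add)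
    with add show ?case
      by (simp add: distrib_left a_pos_add algebra_simps)
  qed simp
  with add show ?case
    by (simp add: distrib_right a_pos_add algebra_simps)
qed simp

lemma a_pos_expP: "a_pos r (expP n) = 0"
proof -
  have "pdiff (r - 1) 1 = 0"
    using pdiff_single[of "r - 1" 0 1] by simp
  then show ?thesis by (simp add: expP_def a_pos_single)
qed

lemma a_pos_scaleL: "a_pos r (scaleL c v) = scaleL c (a_pos r v)"
proof -
  have "a_pos r (embK (constK c)) = 0"
    by (simp add: embK_def constK_def a_pos_single pdiff_single)
  then show ?thesis by (simp add: scaleL_def a_pos_mult)
qed

lemma a_pos_avar:
  assumes "r \<ge> 1" "s \<ge> 1"
  shows "a_pos r (embK (avar s)) = (if r = s then scaleL (a_coeff r) 1 else 0)"
proof (cases "r = s")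
  case True
  then show ?thesis
    by (simp add: embK_def avar_def a_pos_single pdiff_single scaleL_def)
next
  case False
  with assms have "s - 1 \<noteq> r - 1" by simp
  with False show ?thesis
    by (simp add: embK_def avar_def a_pos_single pdiff_single lookup_single when_def)
qed

text \<open>
  Formal series in \<open>z\<^sup>\<plusminus>\<^sup>1\<close> with operator coefficients: \<open>A n\<close> is the coefficient of \<open>z\<^sup>n\<close>. All
  (pointwise) sums below are finite where they are used. In the exponentials, \<open>A\<close> is supported either
  in \<open>n \<ge> 1\<close> or in \<open>n \<le> -1\<close>, so \<open>A(z)\<^sup>k\<close> has no \<open>z\<^sup>n\<close> term for \<open>k > \<bar>n\<bar>\<close>. In the remaining products,
  the right factor applied to a fixed vector has finitely many terms, because every vector is killed
  by all \<open>a(r)\<close> monomials of large degree and has finitely many \<open>P\<close>-components.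
\<close>

type_synonym series = "int \<Rightarrow> fock \<Rightarrow> fock"

definition ser_one :: series where
  "ser_one n v = (if n = 0 then v else 0)"

definition ser_mult :: "series \<Rightarrow> series \<Rightarrow> series" where
  "ser_mult A B n v = Sum_any (\<lambda>k. A k (B (n - k) v))"

primrec ser_pow :: "series \<Rightarrow> nat \<Rightarrow> series" where
  "ser_pow A 0 = ser_one"
| "ser_pow A (Suc k) = ser_mult A (ser_pow A k)"

definition ser_exp :: "series \<Rightarrow> series" where
  "ser_exp A n v = Sum_any (\<lambda>k. scaleL (1 / of_nat (fact k)) (ser_pow A k n v))"

text \<open>The series \<open>\<Sum>\<^sub>r\<^sub>\<ge>\<^sub>1 c\<^sub>r a(-r) z\<^sup>r\<close> and \<open>\<Sum>\<^sub>r\<^sub>\<ge>\<^sub>1 c\<^sub>r a(r) z\<^sup>-\<^sup>r\<close>.\<close>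

definition creation :: "(nat \<Rightarrow> qfield) \<Rightarrow> series" where
  "creation c n v = (if n \<ge> 1 then scaleL (c (nat n)) (a_neg (nat n) v) else 0)"

definition annihilation :: "(nat \<Rightarrow> qfield) \<Rightarrow> series" where
  "annihilation c n v = (if n \<le> -1 then scaleL (c (nat (- n))) (a_pos (nat (- n)) v) else 0)"

text \<open>
  The operator \<open>e\<^sup>\<alpha> z\<^sup>\<partial>\<close> with \<open>\<partial> = \<partial>\<^sub>\<alpha>\<close>. Since \<open>\<alpha> = 2\<lambda>\<close> and \<open>(\<alpha>, n\<lambda>) = n\<close>, the coefficient of \<open>z\<^sup>n\<close>
  in \<open>z\<^sup>\<partial> v\<close> is the component of \<open>v\<close> in \<open>K(1) \<otimes> e\<^sup>n\<^sup>\<lambda>\<close>.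
\<close>

definition e_alpha_z :: series where
  "e_alpha_z n v = expP 2 * Poly_Mapping.single n (Poly_Mapping.lookup v n)"

definition xplus_series :: series where
  "xplus_series =
     ser_mult (ser_exp (creation (\<lambda>r. qh powi (- int r) / qint (int r))))
       (ser_mult (ser_exp (annihilation (\<lambda>r. - (qh powi (- int r) / qint (int r))))) e_alpha_z)"

definition khat_series :: series where
  "khat_series = ser_exp (annihilation (\<lambda>r. (qq - inverse qq) * (- (qh ^ r) / (1 + qq ^ (2 * r)))))"

definition xhat_series :: series where
  "xhat_series = ser_mult xplus_series khat_series"

definition xplus :: "int \<Rightarrow> fock \<Rightarrow> fock" where
  "xplus r = xplus_series (- r - 1)"

definition xhat :: "int \<Rightarrow> fock \<Rightarrow> fock" where
  "xhat r = xhat_series (- r - 1)"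

definition vLambda :: "nat \<Rightarrow> fock" where
  "vLambda i = expP (int i)"

text \<open>
  The (unital) algebra of operators on \<open>L\<close> generated by all \<open>x\<^sup>+(r)\<close>, that is, the image of
  \<open>U\<^sub>q\<close> of \<open>n\<^sup>+\<close>-hat in \<open>End L\<close>.
\<close>

inductive_set Uq_nplus :: "(fock \<Rightarrow> fock) set" where
  one: "(\<lambda>v. v) \<in> Uq_nplus"
| gen: "xplus r \<in> Uq_nplus"
| add: "A \<in> Uq_nplus \<Longrightarrow> B \<in> Uq_nplus \<Longrightarrow> (\<lambda>v. A v + B v) \<in> Uq_nplus"
| scale: "A \<in> Uq_nplus \<Longrightarrow> (\<lambda>v. scaleL c (A v)) \<in> Uq_nplus"
| mult: "A \<in> Uq_nplus \<Longrightarrow> B \<in> Uq_nplus \<Longrightarrow> (\<lambda>v. A (B v)) \<in> Uq_nplus"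

definition principal_subspace :: "nat \<Rightarrow> fock set" where
  "principal_subspace i = {A (vLambda i) | A. A \<in> Uq_nplus}"

text \<open>The list \<open>ls\<close> is \<open>[l\<^sub>1, \<dots>, l\<^sub>m]\<close>; \<open>fold\<close> applies \<open>xhat l\<^sub>1\<close> first.\<close>

definition Bhat :: "nat \<Rightarrow> fock set" where
  "Bhat i = {fold xhat ls (vLambda i) | ls.
     (ls \<noteq> [] \<longrightarrow> ls ! 0 \<le> - 1 - of_bool (i = 1)) \<and>
     (\<forall>r. r + 1 < length ls \<longrightarrow> ls ! (r + 1) \<le> ls ! r - 2)}"

end

theory Submission
  imports Defs
begin

text \<open>
  Write \<open>exp(\<Sum>\<^sub>r\<^sub>\<ge>\<^sub>1 c\<^sub>r a(-r) z\<^sup>r) = \<Sum>\<^sub>k h\<^sub>k z\<^sup>k\<close> for the creation factor common to \<open>x\<^sup>+(z)\<close> and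
  \<open>x(z) = x\<^sup>+(z) k(z)\<close>, and \<open>h\<^sub>\<mu>\<close> for the product of the \<open>h\<^sub>k\<close> over the parts of a list \<open>\<mu>\<close>. Since
  \<open>a(r) h\<^sub>k\<close> is a multiple of \<open>h\<^sub>k\<^sub>-\<^sub>r\<close>, annihilation factors only lower parts. Hence both kinds of modes
  applied to \<open>h\<^sub>\<mu> e\<^sup>n\<^sup>\<lambda>\<close> append one new part to \<open>\<mu>\<close>, up to terms in which weight has moved
  from the old parts to the new one. Iterating from \<open>e\<^sup>i\<^sup>\<lambda>\<close>, the modes with the difference-two
  condition correspond to weakly increasing \<open>\<mu>\<close>, and for such \<open>\<mu>\<close> all correction terms have a strictly
  larger sum of squares. So for \<open>x\<^sup>+\<close> and \<open>x\<close> alike these monomials are unitriangular over the vectors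
  \<open>h\<^sub>\<mu> e\<^sup>(\<^sup>i\<^sup>+\<^sup>2\<^sup>m\<^sup>)\<^sup>\<lambda>\<close>, \<open>\<mu>\<close> of length \<open>m\<close>, whose span is therefore the principal subspace. These vectors are
  independent because the part of \<open>h\<^sub>\<mu>\<close> of lowest polynomial degree is a nonzero multiple of the
  monomial \<open>\<Prod> a(-\<mu>\<^sub>r)\<close> over the nonzero parts.
\<close>

section \<open>Linear series of operators\<close>

interpretation LL: vector_space_pair scaleL scaleL
  by unfold_locales

abbreviation lin :: "(fock \<Rightarrow> fock) \<Rightarrow> bool" where
  "lin \<equiv> Vector_Spaces.linear scaleL scaleL"

lemma linI:
  assumes "\<And>v w. f (v + w) = f v + f w" "\<And>c v. f (scaleL c v) = scaleL c (f v)"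
  shows "lin f"
  using assms by (simp add: Vector_Spaces.linear_iff vector_space_scaleL)

lemma scaleL_single: "scaleL c (Poly_Mapping.single n p) = Poly_Mapping.single n (constK c * p)"
  by (simp add: scaleL_def embK_def mult_single)

lemma lin_mult_left: "lin (\<lambda>v. u * v)"
  by (rule linI) (simp_all add: distrib_left scaleL_def mult_ac)

lemma lin_a_pos: "lin (a_pos r)"
  by (rule linI) (simp_all add: a_pos_add a_pos_scaleL)

lemma lin_zero: "lin (\<lambda>v. 0)"
  by (rule linI) simp_all

lemma lin_id: "lin (\<lambda>v. v)"
  by (rule linI) simp_all

lemma lin_scaleL: "lin f \<Longrightarrow> lin (\<lambda>v. scaleL c (f v))"
  by (rule linI) (simp_all add: LL.linear_add LL.linear_scale L.scale_right_distrib L.scale_left_commute)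

lemma lin_compose: "lin f \<Longrightarrow> lin g \<Longrightarrow> lin (\<lambda>v. f (g v))"
  by (rule linI) (simp_all add: LL.linear_add LL.linear_scale)

text \<open>\<open>Sum_any\<close> is 0 on infinite support, so additivity rests on finiteness for
  each vector; this is the form in which the series products below are locally finite.\<close>

lemma lin_Sum_any:
  fixes T :: "'k \<Rightarrow> fock \<Rightarrow> fock"
  assumes T: "\<And>k. lin (T k)" and fin: "\<And>v. finite {k. T k v \<noteq> 0}"
  shows "lin (\<lambda>v. Sum_any (\<lambda>k. T k v))"
proof (rule linI)
  fix v w
  show "Sum_any (\<lambda>k. T k (v + w)) = Sum_any (\<lambda>k. T k v) + Sum_any (\<lambda>k. T k w)"
    by (simp add: LL.linear_add[OF T] Sum_any.distrib fin)
next
  fix c v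
  show "Sum_any (\<lambda>k. T k (scaleL c v)) = scaleL c (Sum_any (\<lambda>k. T k v))"
    unfolding LL.linear_scale[OF T] by (simp add: scaleL_def Sum_any_right_distrib fin)
qed

lemma Sum_any_in_subspace:
  assumes "L.subspace S" "\<And>k. f k \<in> S"
  shows "Sum_any f \<in> S"
  unfolding Sum_any.expand_set by (rule L.subspace_sum) (use assms in auto)

text \<open>Splits off the one summand that carries a leading term; the remaining ones become its
  corrections.\<close>

lemma Sum_any_diff_in_subspace:
  assumes S: "L.subspace S" and fin: "finite {k. f k \<noteq> 0}" and f: "\<And>k. k \<noteq> a \<Longrightarrow> f k \<in> S"
  shows "Sum_any f - f a \<in> S"
proof -
  have "Sum_any f = sum f (insert a {k. f k \<noteq> 0})"
    by (rule Sum_any.expand_superset) (use fin in auto)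
  also have "\<dots> = f a + sum f ({k. f k \<noteq> 0} - {a})"
    using fin by (simp add: sum.insert_remove)
  finally have "Sum_any f - f a = sum f ({k. f k \<noteq> 0} - {a})" by simp
  also have "\<dots> \<in> S" by (rule L.subspace_sum[OF S]) (use f in auto)
  finally show ?thesis .
qed

lemma Sum_any_eq_single:
  assumes "\<And>k. k \<noteq> a \<Longrightarrow> f k = 0"
  shows "Sum_any f = (f a :: 'a :: comm_monoid_add)"
proof -
  have "Sum_any f = sum f {a}"
    by (rule Sum_any.expand_superset) (use assms in auto)
  then show ?thesis by simp
qed

lemma lin_ser_mult:
  assumes "\<And>n. lin (A n)" "\<And>n. lin (B n)" "\<And>n v. finite {k. A k (B (n - k) v) \<noteq> 0}"
  shows "lin (ser_mult A B n)"
  unfolding ser_mult_def by (rule lin_Sum_any, rule lin_compose) (use assms in auto)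

text \<open>Stated for an arbitrary family \<open>S\<close> because two are used:
  \<open>wt_le\<close>, and the spans of lowered products indexed by minus the removed
  weight.\<close>

definition shifts :: "(int \<Rightarrow> fock set) \<Rightarrow> series \<Rightarrow> bool" where
  "shifts S A \<longleftrightarrow> (\<forall>n b. \<forall>v\<in>S b. A n v \<in> S (b + n))"

lemma shiftsD: "shifts S A \<Longrightarrow> v \<in> S b \<Longrightarrow> A n v \<in> S (b + n)"
  by (auto simp: shifts_def)

context
  fixes S :: "int \<Rightarrow> fock set"
  assumes S: "\<And>b. L.subspace (S b)"
begin

lemma shifts_ser_mult:
  assumes A: "shifts S A" and B: "shifts S B"
  shows "shifts S (ser_mult A B)"
  unfolding shifts_def ser_mult_def
proof (intro allI ballI Sum_any_in_subspace[OF S])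
  fix n b v k assume "v \<in> S b"
  from shiftsD[OF A shiftsD[OF B this], of k "n - k"]
  show "A k (B (n - k) v) \<in> S (b + n)" by simp
qed

lemma shifts_ser_pow: "shifts S A \<Longrightarrow> shifts S (ser_pow A k)"
proof (induction k)
  case 0
  then show ?case by (auto simp: shifts_def ser_one_def L.subspace_0[OF S])
qed (simp add: shifts_ser_mult)

lemma shifts_ser_exp:
  assumes "shifts S A"
  shows "shifts S (ser_exp A)"
  unfolding shifts_def ser_exp_def
  by (intro allI ballI Sum_any_in_subspace[OF S] L.subspace_scale[OF S])
    (rule shiftsD[OF shifts_ser_pow[OF assms]])

lemma shifts_annihilation:
  assumes "\<And>r b v. r \<ge> 1 \<Longrightarrow> v \<in> S b \<Longrightarrow> a_pos r v \<in> S (b - int r)"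
  shows "shifts S (annihilation d)"
  unfolding shifts_def annihilation_def
proof (intro allI ballI)
  fix n b v assume v: "v \<in> S b"
  show "(if n \<le> -1 then scaleL (d (nat (-n))) (a_pos (nat (-n)) v) else 0) \<in> S (b + n)"
    using assms[of "nat (-n)" v b] v L.subspace_scale[OF S] L.subspace_0[OF S]
    by (cases "n \<le> -1") auto
qed

end

section \<open>Exponentials of annihilation series\<close>

lemma lin_annihilation: "lin (annihilation d n)"
  unfolding annihilation_def
  by (cases "n \<le> -1") (simp_all add: lin_scaleL lin_a_pos lin_zero)

text \<open>Each factor has exponents at most -1, so the k-th power has exponents at most -k.
  Linearity is proved in the same induction because this vanishing makes the convolution sum
  finite.\<close>

lemma ser_pow_annihilation:
  "lin (ser_pow (annihilation d) k n) \<and> (n > - int k \<longrightarrow> ser_pow (annihilation d) k n v = 0)"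
proof (induction k arbitrary: n v)
  case 0
  have "lin (\<lambda>v. if n = 0 then v else 0)"
    by (cases "n = 0") (simp_all add: lin_zero lin_id)
  then show ?case by (simp add: ser_one_def)
next
  case (Suc k)
  have z: "annihilation d m (ser_pow (annihilation d) k (n - m) v) = 0"
    if "m > -1 \<or> n - m > - int k" for m v n
  proof (cases "m > -1")
    case True
    then show ?thesis by (simp add: annihilation_def)
  next
    case False
    with that Suc[of "n - m" v] have "ser_pow (annihilation d) k (n - m) v = 0" by simp
    then show ?thesis by (simp add: LL.linear_0[OF lin_annihilation])
  qed
  have "finite {m. annihilation d m (ser_pow (annihilation d) k (n - m) v) \<noteq> 0}" for n v
  proof (rule finite_subset)
    show "{m. annihilation d m (ser_pow (annihilation d) k (n - m) v) \<noteq> 0} \<subseteq> {n..-1}"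
    proof
      fix m assume "m \<in> {m. annihilation d m (ser_pow (annihilation d) k (n - m) v) \<noteq> 0}"
      then have "\<not> (m > -1 \<or> n - m > - int k)" using z[of m n v] by blast
      then show "m \<in> {n..-1}" by auto
    qed
  qed simp
  then have "lin (ser_pow (annihilation d) (Suc k) n)"
    unfolding ser_pow.simps using Suc lin_annihilation by (intro lin_ser_mult) auto
  moreover have "ser_pow (annihilation d) (Suc k) n v = 0" if "n > - int (Suc k)"
  proof -
    have "annihilation d m (ser_pow (annihilation d) k (n - m) v) = 0" for m
      by (rule z) (use that in auto)
    then show ?thesis by (simp add: ser_mult_def)
  qed
  ultimately show ?case by blast
qed

text \<open>Only the powers with k at most -n reach the coefficient of z^n, whatever the
  vector.\<close>

lemma lin_exp_annihilation: "lin (ser_exp (annihilation d) n)"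
  unfolding ser_exp_def
proof (intro lin_Sum_any lin_scaleL)
  fix v
  show "finite {k. scaleL (1 / of_nat (fact k)) (ser_pow (annihilation d) k n v) \<noteq> 0}"
  proof (rule finite_subset)
    show "{k. scaleL (1 / of_nat (fact k)) (ser_pow (annihilation d) k n v) \<noteq> 0} \<subseteq> {..nat (-n)}"
    proof
      fix k assume "k \<in> {k. scaleL (1 / of_nat (fact k)) (ser_pow (annihilation d) k n v) \<noteq> 0}"
      then have "ser_pow (annihilation d) k n v \<noteq> 0" by auto
      then have "\<not> n > - int k" using ser_pow_annihilation by blast
      then show "k \<in> {..nat (-n)}" by simp
    qed
  qed simp
qed (use ser_pow_annihilation in blast)

lemma exp_annihilation_pos: "n > 0 \<Longrightarrow> ser_exp (annihilation d) n v = 0"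
  using ser_pow_annihilation[of d _ n v] by (simp add: ser_exp_def)

lemma exp_annihilation_0: "ser_exp (annihilation d) 0 v = v"
proof -
  have "ser_exp (annihilation d) 0 v = scaleL (1 / of_nat (fact 0)) (ser_pow (annihilation d) 0 0 v)"
    unfolding ser_exp_def
  proof (rule Sum_any_eq_single)
    fix k :: nat assume "k \<noteq> 0"
    then have "0 > - int k" by simp
    then show "scaleL (1 / of_nat (fact k)) (ser_pow (annihilation d) k 0 v) = 0"
      using ser_pow_annihilation[of d k 0 v] by simp
  qed
  then show ?thesis by (simp add: ser_one_def)
qed

section \<open>The weight filtration\<close>

definition mwt :: "(nat \<Rightarrow> nat) \<Rightarrow> (nat \<Rightarrow>\<^sub>0 nat) \<Rightarrow> nat" where
  "mwt g m = (\<Sum>j\<in>Poly_Mapping.keys m. g j * Poly_Mapping.lookup m j)"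

lemma mwt_superset:
  assumes "finite J" "Poly_Mapping.keys m \<subseteq> J"
  shows "mwt g m = (\<Sum>j\<in>J. g j * Poly_Mapping.lookup m j)"
  unfolding mwt_def by (rule sum.mono_neutral_left) (use assms in \<open>auto simp: in_keys_iff\<close>)

lemma mwt_add: "mwt g (m + m') = mwt g m + mwt g m'"
proof -
  let ?J = "Poly_Mapping.keys m \<union> Poly_Mapping.keys m'"
  have "Poly_Mapping.keys (m + m') \<subseteq> ?J" by (rule Poly_Mapping.keys_add)
  then show ?thesis
    using mwt_superset[of ?J m] mwt_superset[of ?J m'] mwt_superset[of ?J "m + m'"]
    by (simp add: lookup_add sum.distrib algebra_simps)
qed

lemma mwt_single: "mwt g (Poly_Mapping.single j k) = g j * k"
  by (cases "k = 0") (simp_all add: mwt_def)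

text \<open>Variable number \<open>j\<close> is \<open>a(-(j+1))\<close>, so \<open>mwt Suc\<close> gives \<open>a(-r)\<close> the weight \<open>r\<close>.\<close>

definition wt_le :: "int \<Rightarrow> fock set" where
  "wt_le b = {v. \<forall>n m. Poly_Mapping.lookup (Poly_Mapping.lookup v n) m \<noteq> 0 \<longrightarrow> int (mwt Suc m) \<le> b}"

lemma lookup_constK_mult: "Poly_Mapping.lookup (constK c * p) m = c * Poly_Mapping.lookup p m"
proof (induction p rule: poly_mapping_add_induct)
  case (add p k d)
  then show ?case
    by (simp add: distrib_left lookup_add constK_def mult_single lookup_single when_def)
qed simp

lemma lookup_scaleL: "Poly_Mapping.lookup (scaleL c v) n = constK c * Poly_Mapping.lookup v n"
proof (induction v rule: poly_mapping_add_induct)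
  case (add p k d)
  then show ?case
    by (simp add: L.scale_right_distrib lookup_add scaleL_single lookup_single when_def distrib_left)
qed simp

lemma subspace_wt_le: "L.subspace (wt_le b)"
proof (rule L.subspaceI)
  fix v w assume vw: "v \<in> wt_le b" "w \<in> wt_le b"
  show "v + w \<in> wt_le b"
    unfolding wt_le_def
  proof (intro CollectI allI impI)
    fix n m assume "Poly_Mapping.lookup (Poly_Mapping.lookup (v + w) n) m \<noteq> 0"
    then have "Poly_Mapping.lookup (Poly_Mapping.lookup v n) m \<noteq> 0 \<or> Poly_Mapping.lookup (Poly_Mapping.lookup w n) m \<noteq> 0"
      by (auto simp: lookup_add)
    with vw show "int (mwt Suc m) \<le> b" by (auto simp: wt_le_def)
  qed
qed (auto simp: wt_le_def lookup_scaleL lookup_constK_mult)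

lemma a_pos_wt_le:
  assumes "r \<ge> 1" "v \<in> wt_le b"
  shows "a_pos r v \<in> wt_le (b - int r)"
  unfolding wt_le_def
proof (intro CollectI allI impI)
  fix n m assume "Poly_Mapping.lookup (Poly_Mapping.lookup (a_pos r v) n) m \<noteq> 0"
  then have "Poly_Mapping.lookup (Poly_Mapping.lookup v n) (m + Poly_Mapping.single (r - 1) 1) \<noteq> 0"
    by (auto simp: lookup_a_pos lookup_constK_mult lookup_pdiff)
  then have "int (mwt Suc (m + Poly_Mapping.single (r - 1) 1)) \<le> b"
    using assms by (auto simp: wt_le_def)
  with assms show "int (mwt Suc m) \<le> b - int r"
    by (simp add: mwt_add mwt_single)
qed

lemma wt_le_neg: "v \<in> wt_le b \<Longrightarrow> b < 0 \<Longrightarrow> v = 0"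
  by (rule poly_mapping_eqI, rule poly_mapping_eqI) (auto simp: wt_le_def intro: ccontr)

lemma wt_le_mono: "v \<in> wt_le b \<Longrightarrow> b \<le> b' \<Longrightarrow> v \<in> wt_le b'"
  by (force simp: wt_le_def)

text \<open>A vector has finitely many monomials. Since annihilation series shift
  \<open>wt_le\<close>, a weight bound limits the negative exponents of z, which yields local
  finiteness of the operator products.\<close>

lemma ex_wt_le: "\<exists>b. v \<in> wt_le b"
proof (induction v rule: poly_mapping_add_induct)
  case zero
  then show ?case by (auto simp: wt_le_def)
next
  case (add v n p)
  have "\<exists>b. Poly_Mapping.single n p \<in> wt_le b"
  proof
    \<comment> \<open>The sum of the weights of all monomials of \<open>p\<close> is a crude common
      bound.\<close>
    show "Poly_Mapping.single n p \<in> wt_le (int (\<Sum>m\<in>Poly_Mapping.keys p. mwt Suc m))"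
      by (auto simp: wt_le_def lookup_single when_def in_keys_iff[symmetric] split: if_splits
          intro!: member_le_sum simp del: of_nat_sum)
  qed
  with add obtain b b' where "v \<in> wt_le b" "Poly_Mapping.single n p \<in> wt_le b'" by blast
  then have "v \<in> wt_le (max b b')" "Poly_Mapping.single n p \<in> wt_le (max b b')"
    by (auto elim: wt_le_mono)
  then show ?case using L.subspace_add[OF subspace_wt_le] by blast
qed

lemma exp_annihilation_wt_le:
  "v \<in> wt_le b \<Longrightarrow> ser_exp (annihilation d) n v \<in> wt_le (b + n)"
  by (rule shiftsD[of wt_le], rule shifts_ser_exp, rule subspace_wt_le,
      rule shifts_annihilation, rule subspace_wt_le, rule a_pos_wt_le)

section \<open>Coefficients of the creation exponential\<close>

lemma of_nat_qfield_eq_0_iff: "(of_nat n :: qfield) = 0 \<longleftrightarrow> n = 0"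
proof -
  have "(of_nat n :: qfield) = Fract (of_nat n) 1" by (simp add: Fract_of_nat_eq)
  also have "\<dots> = 0 \<longleftrightarrow> n = 0" by (simp add: Zero_fract_def eq_fract)
  finally show ?thesis .
qed

lemma constK_mult: "constK a * constK b = constK (a * b)"
  by (simp add: constK_def mult_single)

lemma constK_add: "constK (a + b) = constK a + constK b"
  by (simp add: constK_def single_add)

lemma constK_1 [simp]: "constK 1 = 1"
  by (simp add: constK_def)

lemma embK_mult: "embK (p * p') = embK p * embK p'"
  by (simp add: embK_def mult_single)

lemma embK_0 [simp]: "embK 0 = 0"
  by (simp add: embK_def)

lemma embK_sum: "embK (sum f I) = (\<Sum>i\<in>I. embK (f i))"
  by (induction I rule: infinite_finite_induct) (simp_all add: embK_def single_add)

lemma embK_mult_single: "embK p * Poly_Mapping.single n p' = Poly_Mapping.single n (p * p')"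
  by (simp add: embK_def mult_single)

text \<open>\<open>pK c j k\<close> and \<open>hK c k\<close> are the coefficients of \<open>z\<^sup>k\<close> in \<open>A(z)\<^sup>j\<close> and in \<open>exp A(z)\<close>,
  where \<open>A(z) = \<Sum>\<^sub>r\<^sub>\<ge>\<^sub>1 c\<^sub>r a(-r) z\<^sup>r\<close>.\<close>

primrec pK :: "(nat \<Rightarrow> qfield) \<Rightarrow> nat \<Rightarrow> int \<Rightarrow> K1" where
  "pK c 0 k = (if k = 0 then 1 else 0)"
| "pK c (Suc j) k = (\<Sum>s\<in>{1..k}. constK (c (nat s)) * (avar (nat s) * pK c j (k - s)))"

definition hK :: "(nat \<Rightarrow> qfield) \<Rightarrow> int \<Rightarrow> K1" where
  "hK c k = (\<Sum>j\<le>nat k. constK (1 / of_nat (fact j)) * pK c j k)"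

lemma pK_eq_0: "k < int j \<Longrightarrow> pK c j k = 0"
proof (induction j arbitrary: k)
  case (Suc j)
  then show ?case by (auto intro!: sum.neutral)
qed simp

text \<open>Terms with j > k vanish. The free upper limit lets the coefficients at k and at k - r be
  summed over one range.\<close>

lemma hK_expand:
  assumes "nat k \<le> N"
  shows "hK c k = (\<Sum>j\<le>N. constK (1 / of_nat (fact j)) * pK c j k)"
  unfolding hK_def
  by (rule sum.mono_neutral_left) (use assms in \<open>auto intro!: pK_eq_0 simp: not_le\<close>)

lemma hK_0 [simp]: "hK c 0 = 1"
  by (simp add: hK_def)

lemma hK_neg: "k < 0 \<Longrightarrow> hK c k = 0"
  by (simp add: hK_def)

lemma pK_Suc_superset:
  assumes "k \<le> k'"
  shows "pK c (Suc j) k = (\<Sum>s\<in>{1..k'}. constK (c (nat s)) * (avar (nat s) * pK c j (k - s)))"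
  unfolding pK.simps
  by (rule sum.mono_neutral_left) (use assms in \<open>auto simp: pK_eq_0\<close>)

text \<open>Every a(-s) acts by multiplication in a commutative ring, so operator powers reduce to
  the polynomial recursion \<open>pK\<close>.\<close>

lemma ser_pow_creation: "ser_pow (creation c) j k v = embK (pK c j k) * v"
proof (induction j arbitrary: k)
  case 0
  then show ?case by (simp add: ser_one_def embK_def)
next
  case (Suc j)
  have eq: "creation c s (embK (pK c j (k - s)) * v) =
      (if s \<ge> 1 then embK (constK (c (nat s)) * (avar (nat s) * pK c j (k - s))) * v else 0)" for s
    by (simp add: creation_def scaleL_def a_neg_def embK_mult mult.assoc)
  have "ser_pow (creation c) (Suc j) k v = Sum_any (\<lambda>s. creation c s (embK (pK c j (k - s)) * v))"
    by (simp add: ser_mult_def Suc)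
  also have "\<dots> = (\<Sum>s\<in>{1..k}. creation c s (embK (pK c j (k - s)) * v))"
  proof (rule Sum_any.expand_superset)
    show "{s. creation c s (embK (pK c j (k - s)) * v) \<noteq> 0} \<subseteq> {1..k}"
    proof
      fix s assume "s \<in> {s. creation c s (embK (pK c j (k - s)) * v) \<noteq> 0}"
      then have "s \<ge> 1" "pK c j (k - s) \<noteq> 0" unfolding eq by (auto split: if_splits)
      then have "s \<ge> 1" "k - s \<ge> int j" using pK_eq_0[of "k - s" j c] by fastforce+
      then show "s \<in> {1..k}" by simp
    qed
  qed simp
  also have "\<dots> = embK (pK c (Suc j) k) * v"
    unfolding pK.simps embK_sum sum_distrib_right by (rule sum.cong) (simp_all add: eq)
  finally show ?case .
qed

lemma exp_creation: "ser_exp (creation c) k v = embK (hK c k) * v"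
proof -
  have eq: "scaleL (1 / of_nat (fact j)) (ser_pow (creation c) j k v) =
      embK (constK (1 / of_nat (fact j)) * pK c j k) * v" for j
    by (simp only: ser_pow_creation scaleL_def embK_mult mult.assoc)
  have "ser_exp (creation c) k v = (\<Sum>j\<le>nat k. embK (constK (1 / of_nat (fact j)) * pK c j k) * v)"
    unfolding ser_exp_def eq
  proof (rule Sum_any.expand_superset)
    show "{j. embK (constK (1 / of_nat (fact j)) * pK c j k) * v \<noteq> 0} \<subseteq> {..nat k}"
    proof
      fix j assume "j \<in> {j. embK (constK (1 / of_nat (fact j)) * pK c j k) * v \<noteq> 0}"
      then have "pK c j k \<noteq> 0" by auto
      then show "j \<in> {..nat k}" using pK_eq_0[of k j c] by fastforce
    qed
  qed simp
  then show ?thesis by (simp add: hK_def embK_sum sum_distrib_right)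
qed

section \<open>The derivations a(r) on the exponential coefficients\<close>

definition dK :: "nat \<Rightarrow> K1 \<Rightarrow> K1" where
  "dK r p = constK (a_coeff r) * pdiff (r - 1) p"

lemma a_pos_single_dK: "a_pos r (Poly_Mapping.single n p) = Poly_Mapping.single n (dK r p)"
  by (simp add: a_pos_single dK_def)

lemma dK_0 [simp]: "dK r 0 = 0"
  by (simp add: dK_def)

lemma dK_add: "dK r (p + p') = dK r p + dK r p'"
  by (simp add: dK_def pdiff_add distrib_left)

lemma dK_sum: "dK r (sum f I) = (\<Sum>i\<in>I. dK r (f i))"
  by (induction I rule: infinite_finite_induct) (simp_all add: dK_add)

lemma dK_mult: "dK r (p * p') = dK r p * p' + p * dK r p'"
  by (simp add: dK_def pdiff_mult algebra_simps)

lemma dK_constK: "dK r (constK x) = 0"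
  by (simp add: dK_def constK_def pdiff_single)

lemma dK_constK_mult: "dK r (constK x * p) = constK x * dK r p"
  by (simp add: dK_mult dK_constK)

lemma dK_1 [simp]: "dK r 1 = 0"
  using dK_constK[of r 1] by simp

lemma dK_avar: "r \<ge> 1 \<Longrightarrow> s \<ge> 1 \<Longrightarrow> dK r (avar s) = (if r = s then constK (a_coeff r) else 0)"
  by (auto simp: dK_def avar_def pdiff_single constK_def lookup_single when_def mult_single)

text \<open>Power rule: the derivation a(r) sends A(z) to \<open>c r * a_coeff r\<close> times z^r,
  hence A(z)^(j+1) to (j+1) A(z)^j times that scalar series.\<close>

lemma dK_pK:
  assumes r: "r \<ge> 1"
  shows "dK r (pK c (Suc j) k) = constK (of_nat (Suc j) * (c r * a_coeff r)) * pK c j (k - int r)"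
proof (induction j arbitrary: k)
  case 0
  show ?case
  proof (cases "k \<ge> 1")
    case True
    have "pK c (Suc 0) k = constK (c (nat k)) * avar (nat k)"
      using True by (simp add: if_distrib[of "\<lambda>x. _ * x"] sum.delta' cong: if_cong)
    then show ?thesis using True r by (auto simp: dK_constK_mult dK_avar constK_mult)
  next
    case False
    then show ?thesis using r by simp
  qed
next
  case (Suc j)
  let ?\<kappa> = "c r * a_coeff r"
  have "dK r (pK c (Suc (Suc j)) k) =
     (\<Sum>s\<in>{1..k}. constK (c (nat s)) * (dK r (avar (nat s)) * pK c (Suc j) (k - s))) +
     (\<Sum>s\<in>{1..k}. constK (c (nat s)) * (avar (nat s) * dK r (pK c (Suc j) (k - s))))"
    by (subst pK.simps(2)) (simp add: dK_sum dK_constK dK_mult distrib_left sum.distrib del: pK.simps)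
  also have "(\<Sum>s\<in>{1..k}. constK (c (nat s)) * (dK r (avar (nat s)) * pK c (Suc j) (k - s))) =
      (\<Sum>s\<in>{1..k}. if s = int r then constK ?\<kappa> * pK c (Suc j) (k - int r) else 0)"
    using r by (intro sum.cong refl) (auto simp: dK_avar mult.assoc constK_mult simp del: pK.simps simp flip: mult.assoc)
  \<comment> \<open>If r > k, the index s = r is missing from the sum, but then k - r is negative
    and the right side is 0 as well.\<close>
  also have "\<dots> = constK ?\<kappa> * pK c (Suc j) (k - int r)"
    using r by (auto simp: sum.delta pK_eq_0 simp del: pK.simps)
  also have "(\<Sum>s\<in>{1..k}. constK (c (nat s)) * (avar (nat s) * dK r (pK c (Suc j) (k - s)))) =
      constK (of_nat (Suc j) * ?\<kappa>) *
      (\<Sum>s\<in>{1..k}. constK (c (nat s)) * (avar (nat s) * pK c j (k - int r - s)))"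
    unfolding Suc.IH sum_distrib_left by (intro sum.cong refl) (simp add: mult_ac diff_diff_eq add.commute)
  also have "(\<Sum>s\<in>{1..k}. constK (c (nat s)) * (avar (nat s) * pK c j (k - int r - s))) =
      pK c (Suc j) (k - int r)"
    using pK_Suc_superset[of "k - int r" k c j] by simp
  finally have "dK r (pK c (Suc (Suc j)) k) =
      constK (?\<kappa> + of_nat (Suc j) * ?\<kappa>) * pK c (Suc j) (k - int r)"
    by (simp only: constK_add distrib_right)
  also have "?\<kappa> + of_nat (Suc j) * ?\<kappa> = of_nat (Suc (Suc j)) * ?\<kappa>"
    by (simp add: distrib_right)
  finally show ?case .
qed

text \<open>Coefficient of z^k in a(r) exp A(z) = \<open>c r * a_coeff r\<close> z^r exp A(z), the
  chain rule for the exponential.\<close>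

lemma dK_hK:
  assumes r: "r \<ge> 1"
  shows "dK r (hK c k) = constK (c r * a_coeff r) * hK c (k - int r)"
proof -
  let ?\<kappa> = "c r * a_coeff r"
  \<comment> \<open>One (zero) term is added at the top so that, after j = 0 is split off, the
    shifted sum still runs up to \<open>nat k\<close>.\<close>
  have "hK c k = (\<Sum>j\<le>Suc (nat k). constK (1 / of_nat (fact j)) * pK c j k)"
    by (rule hK_expand) simp
  also have "\<dots> = pK c 0 k + (\<Sum>j\<le>nat k. constK (1 / of_nat (fact (Suc j))) * pK c (Suc j) k)"
    by (subst sum.atMost_Suc_shift) (simp del: pK.simps)
  finally have "dK r (hK c k) =
      (\<Sum>j\<le>nat k. constK (1 / of_nat (fact (Suc j))) * dK r (pK c (Suc j) k))"
    by (simp add: dK_add dK_sum dK_constK_mult del: pK.simps(2) fact_Suc)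
  also have "\<dots> = (\<Sum>j\<le>nat k. constK ?\<kappa> * (constK (1 / of_nat (fact j)) * pK c j (k - int r)))"
  proof (rule sum.cong[OF refl])
    fix j
    have "(1 / (of_nat (Suc j) * of_nat (fact j))) * (of_nat (Suc j) * ?\<kappa>) = ?\<kappa> * (1 / of_nat (fact j) :: qfield)"
      using of_nat_qfield_eq_0_iff[of "Suc j"] of_nat_qfield_eq_0_iff[of "fact j"]
      by (simp add: divide_simps del: of_nat_Suc)
    then show "constK (1 / of_nat (fact (Suc j))) * dK r (pK c (Suc j) k) =
        constK ?\<kappa> * (constK (1 / of_nat (fact j)) * pK c j (k - int r))"
      unfolding dK_pK[OF r] by (simp only: constK_mult fact_Suc of_nat_id of_nat_mult flip: mult.assoc)
  qed
  also have "\<dots> = constK ?\<kappa> * hK c (k - int r)"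
    by (subst hK_expand[of "k - int r" "nat k"]) (simp_all add: sum_distrib_left)
  finally show ?thesis .
qed

text \<open>Entries of \<open>ks\<close> may be negative; \<open>hvec c n ks\<close> is then \<open>0\<close>.\<close>

definition hvec :: "(nat \<Rightarrow> qfield) \<Rightarrow> int \<Rightarrow> int list \<Rightarrow> fock" where
  "hvec c n ks = Poly_Mapping.single n (prod_list (map (hK c) ks))"

definition lowered :: "int \<Rightarrow> int list \<Rightarrow> int list \<Rightarrow> bool" where
  "lowered j ks ks' \<longleftrightarrow> list_all2 (\<le>) ks' ks \<and> sum_list ks' = sum_list ks - j"

lemma lowered_trans: "lowered j ks ks' \<Longrightarrow> lowered j' ks' ks'' \<Longrightarrow> lowered (j + j') ks ks''"
  unfolding lowered_def by (auto intro: list_all2_trans[rotated] order_trans)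

lemma lowered_refl: "lowered 0 ks ks"
  by (simp add: lowered_def list_all2_refl)

lemma lowered_Cons: "lowered j ks ks' \<Longrightarrow> lowered j (k # ks) (k # ks')"
  by (simp add: lowered_def)

definition lowered_span :: "(nat \<Rightarrow> qfield) \<Rightarrow> int \<Rightarrow> int list \<Rightarrow> int \<Rightarrow> fock set" where
  "lowered_span c n ks j = L.span {hvec c n ks' | ks'. lowered j ks ks'}"

text \<open>Leibniz rule combined with \<open>dK_hK\<close>: each summand lowers a single part by
  r.\<close>

lemma a_pos_hvec: "r \<ge> 1 \<Longrightarrow> a_pos r (hvec c n ks) \<in> lowered_span c n ks (int r)"
proof (induction ks)
  case Nil
  then show ?case by (simp add: hvec_def a_pos_single_dK lowered_span_def L.span_zero)
next
  case (Cons k ks)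
  let ?p = "prod_list (map (hK c) ks)"
  have "a_pos r (hvec c n (k # ks)) =
      scaleL (c r * a_coeff r) (hvec c n ((k - int r) # ks)) + embK (hK c k) * a_pos r (hvec c n ks)"
    using Cons.prems
    by (simp add: hvec_def a_pos_single_dK dK_mult dK_hK scaleL_single embK_mult_single mult.assoc
        flip: single_add)
  moreover have "scaleL (c r * a_coeff r) (hvec c n ((k - int r) # ks)) \<in> lowered_span c n (k # ks) (int r)"
    unfolding lowered_span_def
    by (intro L.span_scale L.span_base) (force simp: lowered_def list_all2_refl)
  \<comment> \<open>Multiplication by \<open>hK c k\<close> is linear and prepends the part k, so it
    carries lowerings of \<open>ks\<close> to lowerings of \<open>k # ks\<close>.\<close>
  moreover have "embK (hK c k) * v \<in> lowered_span c n (k # ks) (int r)" if "v \<in> lowered_span c n ks (int r)" for v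
  proof -
    from that have "embK (hK c k) * v \<in> L.span ((\<lambda>v. embK (hK c k) * v) ` {hvec c n ks' | ks'. lowered (int r) ks ks'})"
      unfolding lowered_span_def LL.linear_span_image[OF lin_mult_left] by blast
    also have "\<dots> \<subseteq> lowered_span c n (k # ks) (int r)"
      unfolding lowered_span_def
    proof (rule L.span_mono, safe)
      fix ks' assume "lowered (int r) ks ks'"
      then show "\<exists>ks''. embK (hK c k) * hvec c n ks' = hvec c n ks'' \<and> lowered (int r) (k # ks) ks''"
        by (intro exI[of _ "k # ks'"]) (simp add: hvec_def embK_mult_single lowered_Cons)
    qed
    finally show ?thesis .
  qed
  ultimately show ?case
    using Cons by (auto simp: lowered_span_def intro: L.span_add)
qed

lemma lin_span_subset:
  assumes "lin f" "v \<in> L.span B" "L.subspace S" "\<And>b. b \<in> B \<Longrightarrow> f b \<in> S"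
  shows "f v \<in> S"
proof -
  have "f v \<in> L.span (f ` B)" using assms LL.linear_span_image by blast
  also have "\<dots> \<subseteq> S" by (rule L.span_minimal) (use assms in auto)
  finally show ?thesis .
qed

lemma lowered_span_lowered: "lowered j ks ks' \<Longrightarrow> lowered_span c n ks' j' \<subseteq> lowered_span c n ks (j + j')"
  unfolding lowered_span_def by (rule L.span_mono) (auto dest: lowered_trans)

lemma subspace_lowered_span: "L.subspace (lowered_span c n ks j)"
  by (simp add: lowered_span_def)

text \<open>In the series a(r) comes with z^(-r) and removes weight r. With the index negated, the
  lowered spans therefore form a family shifted by the annihilation series, and so by its
  exponential.\<close>

lemma exp_annihilation_hvec:
  "ser_exp (annihilation d) (- j) (hvec c n ks) \<in> lowered_span c n ks j"
proof -
  have "shifts (\<lambda>b. lowered_span c n ks (- b)) (ser_exp (annihilation d))"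
  proof (rule shifts_ser_exp, rule subspace_lowered_span, rule shifts_annihilation, rule subspace_lowered_span)
    fix r b v assume r: "(r::nat) \<ge> 1" and v: "v \<in> lowered_span c n ks (- b)"
    show "a_pos r v \<in> lowered_span c n ks (- (b - int r))"
    proof (rule lin_span_subset[OF lin_a_pos v[unfolded lowered_span_def] subspace_lowered_span])
      fix w assume "w \<in> {hvec c n ks' |ks'. lowered (- b) ks ks'}"
      then obtain ks' where w: "w = hvec c n ks'" and ks': "lowered (- b) ks ks'" by blast
      show "a_pos r w \<in> lowered_span c n ks (- (b - int r))"
        using a_pos_hvec[OF r, of c n ks'] lowered_span_lowered[OF ks', of c n "int r"]
        unfolding w by (auto simp: algebra_simps)
    qed
  qed
  moreover have "hvec c n ks \<in> lowered_span c n ks (- 0)"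
    unfolding lowered_span_def by (rule L.span_base) (use lowered_refl in auto)
  ultimately have "ser_exp (annihilation d) (- j) (hvec c n ks) \<in> lowered_span c n ks (- (0 + - j))"
    by (rule shiftsD[where S = "\<lambda>b. lowered_span c n ks (- b)"])
  then show ?thesis by simp
qed

section \<open>Vertex operators are triangular\<close>

lemma e_alpha_z_single:
  "e_alpha_z p (Poly_Mapping.single n x) = (if p = n then Poly_Mapping.single (n + 2) x else 0)"
  by (auto simp: e_alpha_z_def expP_def mult_single lookup_single when_def add.commute)

lemma lookup_expP_mult: "Poly_Mapping.lookup (expP k * v) n = Poly_Mapping.lookup v (n - k)"
proof (induction v rule: poly_mapping_add_induct)
  case (add v m x)
  then show ?case
    by (auto simp: distrib_left lookup_add expP_def mult_single lookup_single when_def)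
qed simp

lemma lookup_e_alpha_z:
  "Poly_Mapping.lookup (e_alpha_z p v) n = (if n = p + 2 then Poly_Mapping.lookup v p else 0)"
  by (auto simp: e_alpha_z_def lookup_expP_mult lookup_single when_def)

lemma lin_e_alpha_z: "lin (e_alpha_z p)"
  by (rule linI; rule poly_mapping_eqI)
    (simp_all add: lookup_e_alpha_z lookup_add lookup_scaleL)

lemma e_alpha_z_eq_0: "p \<notin> Poly_Mapping.keys v \<Longrightarrow> e_alpha_z p v = 0"
  by (rule poly_mapping_eqI) (simp add: lookup_e_alpha_z in_keys_iff)

lemma e_alpha_z_wt_le: "v \<in> wt_le b \<Longrightarrow> e_alpha_z p v \<in> wt_le b"
  by (auto simp: wt_le_def lookup_e_alpha_z)

definition vop_right :: "(nat \<Rightarrow> qfield) \<Rightarrow> series" where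
  "vop_right d = ser_mult (ser_exp (annihilation d)) e_alpha_z"

definition vop :: "(nat \<Rightarrow> qfield) \<Rightarrow> (nat \<Rightarrow> qfield) \<Rightarrow> series" where
  "vop c d = ser_mult (ser_exp (creation c)) (vop_right d)"

lemma exp_annihilation_eq_0:
  "v \<in> wt_le b \<Longrightarrow> n < - b \<Longrightarrow> ser_exp (annihilation d) n v = 0"
  by (rule wt_le_neg[OF exp_annihilation_wt_le]) auto

text \<open>\<open>e_alpha_z\<close> selects one lattice component, and a vector has only finitely
  many.\<close>

lemma lin_vop_right: "lin (vop_right d m)"
  unfolding vop_right_def
proof (rule lin_ser_mult[OF lin_exp_annihilation lin_e_alpha_z])
  fix n v
  show "finite {k. ser_exp (annihilation d) k (e_alpha_z (n - k) v) \<noteq> 0}"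
  proof (rule finite_subset)
    show "{k. ser_exp (annihilation d) k (e_alpha_z (n - k) v) \<noteq> 0} \<subseteq> (\<lambda>p. n - p) ` Poly_Mapping.keys v"
    proof
      fix k assume k: "k \<in> {k. ser_exp (annihilation d) k (e_alpha_z (n - k) v) \<noteq> 0}"
      have "n - k \<in> Poly_Mapping.keys v"
      proof (rule ccontr)
        assume "n - k \<notin> Poly_Mapping.keys v"
        then show False using k by (simp add: e_alpha_z_eq_0 LL.linear_0[OF lin_exp_annihilation])
      qed
      then show "k \<in> (\<lambda>p. n - p) ` Poly_Mapping.keys v" by (rule rev_image_eqI) simp
    qed
  qed simp
qed

text \<open>The lattice exponents of \<open>v\<close> are bounded below by l, and annihilation
  lowers exponents by at most a weight bound b. This truncation makes the product with the creation
  series, whose exponents are nonnegative, locally finite.\<close>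

lemma vop_right_bounded_below: "\<exists>B. \<forall>m<B. vop_right d m v = 0"
proof -
  obtain b where b: "v \<in> wt_le b" using ex_wt_le by blast
  have "bdd_below (Poly_Mapping.keys v)" by (simp add: bdd_below_finite)
  then obtain l where l: "\<And>p. p \<in> Poly_Mapping.keys v \<Longrightarrow> l \<le> p" by (auto simp: bdd_below_def)
  have "ser_exp (annihilation d) k (e_alpha_z (m - k) v) = 0" if "m < l - b" for m k
  proof (cases "m - k \<in> Poly_Mapping.keys v")
    case True
    then show ?thesis
      using l[OF True] that by (intro exp_annihilation_eq_0[OF e_alpha_z_wt_le[OF b]]) simp
  next
    case False
    then show ?thesis by (simp add: e_alpha_z_eq_0 LL.linear_0[OF lin_exp_annihilation])
  qed
  then show ?thesis by (intro exI[of _ "l - b"]) (simp add: vop_right_def ser_mult_def)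
qed

lemma lin_exp_creation: "lin (ser_exp (creation c) n)"
  using lin_mult_left[of "embK (hK c n)"] by (simp add: exp_creation[abs_def])

lemma finite_vop_support:
  "finite {k. ser_exp (creation c) k (vop_right d (n - k) v) \<noteq> 0}"
proof -
  obtain B where B: "\<And>m. m < B \<Longrightarrow> vop_right d m v = 0" using vop_right_bounded_below by blast
  show ?thesis
  proof (rule finite_subset)
    show "{k. ser_exp (creation c) k (vop_right d (n - k) v) \<noteq> 0} \<subseteq> {0..n - B}"
    proof
      fix k assume "k \<in> {k. ser_exp (creation c) k (vop_right d (n - k) v) \<noteq> 0}"
      then have "hK c k \<noteq> 0" "vop_right d (n - k) v \<noteq> 0" by (auto simp: exp_creation)
      then have "\<not> k < 0" "\<not> n - k < B" using hK_neg B by blast+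
      then show "k \<in> {0..n - B}" by simp
    qed
  qed simp
qed

lemma lin_vop: "lin (vop c d m)"
  unfolding vop_def by (rule lin_ser_mult[OF lin_exp_creation lin_vop_right finite_vop_support])

text \<open>The correction terms: weight j taken from the old parts goes to the new one, so the
  total stays that of \<open>ks @ [N]\<close>.\<close>

definition raised_span :: "(nat \<Rightarrow> qfield) \<Rightarrow> int \<Rightarrow> int list \<Rightarrow> int \<Rightarrow> fock set" where
  "raised_span c n ks N = L.span {hvec c (n + 2) (ks' @ [N + j]) | ks' j. j \<ge> 1 \<and> lowered j ks ks'}"

lemma subspace_raised_span: "L.subspace (raised_span c n ks N)"
  by (simp add: raised_span_def)

text \<open>Up to a triangular correction, the coefficient of \<open>z\<^sup>m\<close> in a vertex operator appends the part
  \<open>m - n\<close>.\<close>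

definition vertex :: "(nat \<Rightarrow> qfield) \<Rightarrow> series \<Rightarrow> bool" where
  "vertex c X \<longleftrightarrow> (\<forall>m. lin (X m)) \<and>
     (\<forall>m n ks. X m (hvec c n ks) - hvec c (n + 2) (ks @ [m - n]) \<in> raised_span c n ks (m - n))"

lemma vop_right_hvec: "vop_right d m (hvec c n ks) = ser_exp (annihilation d) (m - n) (hvec c (n + 2) ks)"
proof -
  have "vop_right d m (hvec c n ks) =
      ser_exp (annihilation d) (m - n) (e_alpha_z (m - (m - n)) (hvec c n ks))"
    unfolding vop_right_def ser_mult_def
    by (rule Sum_any_eq_single) (auto simp: hvec_def e_alpha_z_single LL.linear_0[OF lin_exp_annihilation])
  then show ?thesis by (simp add: hvec_def e_alpha_z_single)
qed

lemma exp_creation_hvec: "ser_exp (creation c) k (hvec c n ks) = hvec c n (ks @ [k])"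
  by (simp add: exp_creation hvec_def embK_mult_single mult.commute)

text \<open>Let k be the exponent used in the creation factor and j = k - (m - n). The annihilation
  factor then has exponent -j: it is zero for j < 0, the identity for j = 0, and for j >= 1 it
  lowers the old parts by j in total while creation appends m - n + j.\<close>

lemma vertex_vop: "vertex c (vop c d)"
  unfolding vertex_def
proof (intro conjI allI lin_vop)
  fix m n ks
  let ?f = "\<lambda>k. ser_exp (creation c) k (vop_right d (m - k) (hvec c n ks))"
  have "Sum_any ?f - ?f (m - n) \<in> raised_span c n ks (m - n)"
  proof (rule Sum_any_diff_in_subspace[OF subspace_raised_span finite_vop_support])
    fix k assume k: "k \<noteq> m - n"
    show "?f k \<in> raised_span c n ks (m - n)"
    proof (cases "k < m - n")
      case True
      then show ?thesis
        using L.subspace_0[OF subspace_raised_span]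
        by (simp add: vop_right_hvec exp_annihilation_pos LL.linear_0[OF lin_exp_creation])
    next
      case False
      define j where "j = k - (m - n)"
      have "j \<ge> 1" and kj: "k = (m - n) + j" using k False by (auto simp: j_def)
      have "vop_right d (m - k) (hvec c n ks) \<in> lowered_span c (n + 2) ks j"
        unfolding vop_right_hvec using exp_annihilation_hvec[of d j] by (simp add: j_def algebra_simps)
      then show ?thesis
        unfolding lowered_span_def
      proof (rule lin_span_subset[OF lin_exp_creation _ subspace_raised_span])
        fix w assume "w \<in> {hvec c (n + 2) ks' |ks'. lowered j ks ks'}"
        then obtain ks' where "w = hvec c (n + 2) ks'" "lowered j ks ks'" by blast
        then show "ser_exp (creation c) k w \<in> raised_span c n ks (m - n)"
          using \<open>j \<ge> 1\<close> unfolding raised_span_def kj by (simp only: exp_creation_hvec, intro L.span_base) blast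
      qed
    qed
  qed
  then show "vop c d m (hvec c n ks) - hvec c (n + 2) (ks @ [m - n]) \<in> raised_span c n ks (m - n)"
    by (simp add: vop_def ser_mult_def vop_right_hvec exp_annihilation_0 exp_creation_hvec)
qed

text \<open>Successive transfers to the last part add up: j first, then j', is a single transfer of
  j + j'.\<close>

lemma raised_span_lowered:
  assumes "lowered j ks ks'" "j \<ge> 0"
  shows "raised_span c n ks' (N + j) \<subseteq> raised_span c n ks N"
  unfolding raised_span_def
proof (rule L.span_mono, safe)
  fix ks'' j' assume j': "(1::int) \<le> j'" "lowered j' ks' ks''"
  have "lowered (j + j') ks ks''" using assms(1) j'(2) by (rule lowered_trans)
  then show "\<exists>us i. hvec c (n + 2) (ks'' @ [N + j + j']) = hvec c (n + 2) (us @ [N + i]) \<and>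
      1 \<le> i \<and> lowered i ks us"
    using j' assms(2) by (intro exI[of _ ks''] exI[of _ "j + j'"]) (simp add: add.assoc)
qed

text \<open>The constant term of the new factor is the identity and keeps the leading term. At
  exponent -j it lowers the old parts by j, and \<open>X\<close> then acts at an exponent larger by
  j, so leading term and corrections alike are transfers to the last part.\<close>

lemma vertex_ser_mult_exp_annihilation:
  assumes X: "vertex c X"
  shows "vertex c (ser_mult X (ser_exp (annihilation d)))"
proof -
  have linX: "lin (X m)" for m using X by (simp add: vertex_def)
  have fin: "finite {k. X k (ser_exp (annihilation d) (m - k) v) \<noteq> 0}" for m v
  proof -
    obtain b where b: "v \<in> wt_le b" using ex_wt_le by blast
    show ?thesis
    proof (rule finite_subset)
      show "{k. X k (ser_exp (annihilation d) (m - k) v) \<noteq> 0} \<subseteq> {m..m + b}"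
      proof
        fix k assume "k \<in> {k. X k (ser_exp (annihilation d) (m - k) v) \<noteq> 0}"
        then have "ser_exp (annihilation d) (m - k) v \<noteq> 0" by (auto simp: LL.linear_0[OF linX])
        then have "\<not> m - k > 0" "\<not> m - k < - b"
          using exp_annihilation_pos exp_annihilation_eq_0[OF b] by blast+
        then show "k \<in> {m..m + b}" by simp
      qed
    qed simp
  qed
  show ?thesis
    unfolding vertex_def
  proof (intro conjI allI lin_ser_mult linX lin_exp_annihilation fin)
    fix m n ks
    let ?f = "\<lambda>k. X k (ser_exp (annihilation d) (m - k) (hvec c n ks))"
    have "Sum_any ?f - ?f m \<in> raised_span c n ks (m - n)"
    proof (rule Sum_any_diff_in_subspace[OF subspace_raised_span fin])
      fix k assume k: "k \<noteq> m"
      show "?f k \<in> raised_span c n ks (m - n)"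
      proof (cases "k < m")
        case True
        then show ?thesis
          using L.subspace_0[OF subspace_raised_span] by (simp add: exp_annihilation_pos LL.linear_0[OF linX])
      next
        case False
        define j where "j = k - m"
        have j: "j \<ge> 1" and kj: "k - n = (m - n) + j" using k False by (auto simp: j_def)
        have "ser_exp (annihilation d) (m - k) (hvec c n ks) \<in> lowered_span c n ks j"
          using exp_annihilation_hvec[of d j] by (simp add: j_def)
        then show ?thesis
          unfolding lowered_span_def
        proof (rule lin_span_subset[OF linX _ subspace_raised_span])
          fix w assume "w \<in> {hvec c n ks' |ks'. lowered j ks ks'}"
          then obtain ks' where w: "w = hvec c n ks'" and ks': "lowered j ks ks'" by blast
          have "X k w - hvec c (n + 2) (ks' @ [k - n]) \<in> raised_span c n ks' (k - n)"
            using X unfolding w vertex_def by blast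
          also have "\<dots> \<subseteq> raised_span c n ks (m - n)"
            unfolding kj using j by (intro raised_span_lowered[OF ks']) simp
          finally have "X k w - hvec c (n + 2) (ks' @ [k - n]) \<in> raised_span c n ks (m - n)" .
          moreover have "hvec c (n + 2) (ks' @ [k - n]) \<in> raised_span c n ks (m - n)"
            unfolding raised_span_def kj using ks' j by (intro L.span_base) blast
          ultimately have "X k w - hvec c (n + 2) (ks' @ [k - n]) + hvec c (n + 2) (ks' @ [k - n])
              \<in> raised_span c n ks (m - n)"
            by (rule L.subspace_add[OF subspace_raised_span])
          then show "X k w \<in> raised_span c n ks (m - n)" by simp
        qed
      qed
    qed
    then have "ser_mult X (ser_exp (annihilation d)) m (hvec c n ks) - X m (hvec c n ks)
        \<in> raised_span c n ks (m - n)"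
      by (simp add: ser_mult_def exp_annihilation_0)
    moreover have "X m (hvec c n ks) - hvec c (n + 2) (ks @ [m - n]) \<in> raised_span c n ks (m - n)"
      using X by (simp add: vertex_def)
    ultimately have "(ser_mult X (ser_exp (annihilation d)) m (hvec c n ks) - X m (hvec c n ks)) +
        (X m (hvec c n ks) - hvec c (n + 2) (ks @ [m - n])) \<in> raised_span c n ks (m - n)"
      by (rule L.subspace_add[OF subspace_raised_span])
    then show "ser_mult X (ser_exp (annihilation d)) m (hvec c n ks) - hvec c (n + 2) (ks @ [m - n])
        \<in> raised_span c n ks (m - n)"
      by simp
  qed
qed

section \<open>Linear independence\<close>

text \<open>In a linear relation take an index x of minimal rank with nonzero coefficient. By
  \<open>tri\<close>, \<open>\<phi> x\<close> kills every other member that occurs, so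
  \<open>diag\<close> makes the coefficient at x zero.\<close>

lemma independent_triangular:
  fixes f :: "'i \<Rightarrow> fock" and rank :: "'i \<Rightarrow> nat" and \<phi> :: "'i \<Rightarrow> fock \<Rightarrow> qfield"
  assumes add: "\<And>x v w. \<phi> x (v + w) = \<phi> x v + \<phi> x w"
    and scale: "\<And>x c v. \<phi> x (scaleL c v) = c * \<phi> x v"
    and diag: "\<And>x. x \<in> I \<Longrightarrow> \<phi> x (f x) \<noteq> 0"
    and tri: "\<And>x y. x \<in> I \<Longrightarrow> y \<in> I \<Longrightarrow> \<phi> x (f y) \<noteq> 0 \<Longrightarrow> y = x \<or> rank y < rank x"
  shows "inj_on f I" and "L.independent (f ` I)"
proof -
  show inj: "inj_on f I"
  proof (rule inj_onI)
    fix x y assume xy: "x \<in> I" "y \<in> I" "f x = f y"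
    then show "x = y"
      using tri[of x y] tri[of y x] diag[of x] diag[of y] by auto
  qed
  show "L.independent (f ` I)"
    unfolding L.dependent_explicit
  proof clarify
    fix S u v0
    assume S: "finite S" "S \<subseteq> f ` I" and 0: "(\<Sum>v\<in>S. scaleL (u v) v) = 0"
      and v0: "v0 \<in> S" "u v0 \<noteq> 0"
    define T where "T = {x \<in> I. f x \<in> S \<and> u (f x) \<noteq> 0}"
    have "T \<noteq> {}" using S v0 by (auto simp: T_def)
    then obtain x where x: "x \<in> T" and min: "\<And>y. y \<in> T \<Longrightarrow> rank x \<le> rank y"
      using arg_min_natI[of "\<lambda>x. x \<in> T" _ rank] arg_min_nat_le[of "\<lambda>x. x \<in> T" _ rank] by (metis ex_in_conv)
    have \<phi>0: "\<phi> x 0 = 0" using scale[of x 0 0] by simp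
    have "\<phi> x (\<Sum>v\<in>S. scaleL (u v) v) = (\<Sum>v\<in>S. u v * \<phi> x v)"
      using S(1) by (induction S) (simp_all add: \<phi>0 add scale)
    also have "\<dots> = (\<Sum>v\<in>{f x}. u v * \<phi> x v)"
    proof (rule sum.mono_neutral_right)
      show "\<forall>v\<in>S - {f x}. u v * \<phi> x v = 0"
      proof
        fix v assume v: "v \<in> S - {f x}"
        then obtain y where y: "y \<in> I" "v = f y" using S by auto
        show "u v * \<phi> x v = 0"
        proof (rule ccontr)
          assume nz: "u v * \<phi> x v \<noteq> 0"
          then have "y \<in> T" using y v by (auto simp: T_def)
          moreover have "y = x \<or> rank y < rank x"
            using tri[of x y] x y nz by (auto simp: T_def)
          ultimately show False using min[of y] y v by auto
        qed
      qed
    qed (use S x in \<open>auto simp: T_def\<close>)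
    finally have "u (f x) * \<phi> x (f x) = 0" using 0 \<phi>0 by simp
    then show False using x diag by (auto simp: T_def)
  qed
qed

text \<open>The functional attached to x is the coordinate along \<open>b x\<close>. Corrections of
  strictly larger rank give the triangularity that \<open>independent_triangular\<close> asks
  for.\<close>

lemma independent_triangular_change:
  fixes b f :: "'i \<Rightarrow> fock" and rank :: "'i \<Rightarrow> nat"
  assumes inj: "inj_on b I" and ind: "L.independent (b ` I)"
    and f: "\<And>x. x \<in> I \<Longrightarrow> f x - b x \<in> L.span (b ` {y \<in> I. rank x < rank y})"
  shows "L.independent (f ` I)"
proof (rule independent_triangular(2)[where rank = rank
      and \<phi> = "\<lambda>x v. L.representation (L.extend_basis (b ` I)) v (b x)"])
  \<comment> \<open>Extension to a basis of the whole space makes the coordinates additive on all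
    vectors.\<close>
  let ?B = "L.extend_basis (b ` I)"
  have B: "L.independent ?B" "L.span ?B = UNIV" "b ` I \<subseteq> ?B"
    using L.independent_extend_basis[OF ind] L.span_extend_basis[OF ind] L.extend_basis_superset[OF ind]
    by auto
  show "L.representation ?B (v + w) (b x) = L.representation ?B v (b x) + L.representation ?B w (b x)" for x v w
    using B by (simp add: L.representation_add)
  show "L.representation ?B (scaleL c v) (b x) = c * L.representation ?B v (b x)" for x c v
    using B by (simp add: L.representation_scale)
  have rep: "L.representation ?B (f y) (b x) =
      (if b x = b y then 1 else 0) + L.representation ?B (f y - b y) (b x)"
    if "y \<in> I" for x y
  proof -
    have "L.representation ?B (b y + (f y - b y)) (b x) =
        L.representation ?B (b y) (b x) + L.representation ?B (f y - b y) (b x)"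
      by (subst L.representation_add) (use B in auto)
    then show ?thesis using that B by (auto simp: L.representation_basis)
  qed
  have rest: "rank y < rank x"
    if "x \<in> I" "y \<in> I" "L.representation ?B (f y - b y) (b x) \<noteq> 0" for x y
  proof -
    let ?S = "b ` {z \<in> I. rank y < rank z}"
    have "L.representation ?B (f y - b y) = L.representation ?S (f y - b y)"
      using B f[OF that(2)] by (intro L.representation_extend) auto
    with that(3) have "b x \<in> ?S" using L.representation_ne_zero by fastforce
    then show ?thesis using inj that by (auto dest: inj_onD)
  qed
  show "L.representation ?B (f x) (b x) \<noteq> 0" if "x \<in> I" for x
    using rep[OF that, of x] rest[OF that that] by fastforce
  show "y = x \<or> rank y < rank x"
    if "x \<in> I" "y \<in> I" "L.representation ?B (f y) (b x) \<noteq> 0" for x y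
  proof (cases "b x = b y")
    case True
    then show ?thesis using inj that by (auto dest: inj_onD)
  next
    case False
    then show ?thesis using rep[of y x] rest[of x y] that by auto
  qed
qed

section \<open>Lowest-degree parts of the products\<close>

definition deg_ge :: "nat \<Rightarrow> K1 set" where
  "deg_ge d = {p. \<forall>m\<in>Poly_Mapping.keys p. d \<le> mwt (\<lambda>_. Suc 0) m}"

lemma deg_ge_0 [simp]: "0 \<in> deg_ge d"
  by (simp add: deg_ge_def)

lemma deg_ge_add: "p \<in> deg_ge d \<Longrightarrow> p' \<in> deg_ge d \<Longrightarrow> p + p' \<in> deg_ge d"
  using Poly_Mapping.keys_add[of p p'] by (auto simp: deg_ge_def)

lemma deg_ge_mult: "p \<in> deg_ge d \<Longrightarrow> p' \<in> deg_ge d' \<Longrightarrow> p * p' \<in> deg_ge (d + d')"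
  using keys_mult[of p p'] by (fastforce simp: deg_ge_def mwt_add intro: add_mono)

lemma deg_ge_sum: "(\<And>i. i \<in> I \<Longrightarrow> f i \<in> deg_ge d) \<Longrightarrow> sum f I \<in> deg_ge d"
  by (induction I rule: infinite_finite_induct) (simp_all add: deg_ge_add)

lemma deg_ge_any: "p \<in> deg_ge 0"
  by (simp add: deg_ge_def)

lemma deg_ge_mono: "p \<in> deg_ge d \<Longrightarrow> d' \<le> d \<Longrightarrow> p \<in> deg_ge d'"
  by (force simp: deg_ge_def)

lemma deg_ge_mult_left: "p \<in> deg_ge d \<Longrightarrow> p' * p \<in> deg_ge d"
  using deg_ge_mult[OF deg_ge_any, of p d p'] by simp

lemma avar_deg_ge: "avar s \<in> deg_ge 1"
  by (simp add: deg_ge_def avar_def mwt_single)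

lemma pK_deg_ge: "pK c j k \<in> deg_ge j"
proof (induction j arbitrary: k)
  case 0
  show ?case by (rule deg_ge_any)
next
  case (Suc j)
  then show ?case
    unfolding pK.simps using deg_ge_mult[OF avar_deg_ge Suc]
    by (intro deg_ge_sum deg_ge_mult_left[of "avar _ * _"]) simp
qed

text \<open>For k >= 0 this is the part of \<open>hK c k\<close> of degree at most 1; the value at
  negative k has no meaning.\<close>

definition lead :: "(nat \<Rightarrow> qfield) \<Rightarrow> int \<Rightarrow> K1" where
  "lead c k = (if k = 0 then 1 else constK (c (nat k)) * avar (nat k))"

lemma lead_deg_ge: "lead c k \<in> deg_ge (of_bool (k \<noteq> 0))"
  using avar_deg_ge by (auto simp: lead_def deg_ge_any intro: deg_ge_mult_left)

text \<open>For k >= 1 the j = 0 term of the exponential is absent, j = 1 is \<open>lead\<close>,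
  and j >= 2 has degree at least 2.\<close>

lemma hK_minus_lead_deg_ge:
  assumes "k \<ge> 0"
  shows "hK c k - lead c k \<in> deg_ge (of_bool (k \<noteq> 0) + 1)"
proof (cases "k = 0")
  case True
  then show ?thesis by (simp add: lead_def)
next
  case False
  then have k: "k \<ge> 1" using assms by simp
  define g where "g j = constK (1 / of_nat (fact j)) * pK c j k" for j
  have 1: "pK c (Suc 0) k = lead c k"
    using k by (simp add: lead_def if_distrib[of "\<lambda>x. _ * x"] sum.delta' cong: if_cong)
  have "hK c k = (\<Sum>j\<in>{..nat k}. g j)" by (simp add: hK_def g_def)
  also have "{..nat k} = insert 0 (insert 1 {2..nat k})" using k by auto
  also have "sum g \<dots> = g 0 + (g 1 + (\<Sum>j\<in>{2..nat k}. g j))" by simp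
  also have "g 0 = 0" using k by (simp add: g_def)
  also have "g 1 = lead c k" using 1 by (simp add: g_def del: pK.simps)
  finally have "hK c k - lead c k = (\<Sum>j\<in>{2..nat k}. g j)" by simp
  also have "\<dots> \<in> deg_ge 2"
    unfolding g_def by (intro deg_ge_sum deg_ge_mult_left) (rule deg_ge_mono[OF pK_deg_ge], simp)
  finally show ?thesis using False by (simp add: numeral_2_eq_2)
qed

definition npos :: "int list \<Rightarrow> nat" where
  "npos ks = sum_list (map (\<lambda>k. of_bool (k \<noteq> 0)) ks)"

lemma prod_lead_deg_ge: "prod_list (map (lead c) ks) \<in> deg_ge (npos ks)"
proof (induction ks)
  case Nil
  show ?case by (simp add: npos_def deg_ge_any)
next
  case (Cons k ks)
  then show ?case using deg_ge_mult[OF lead_deg_ge Cons] by (simp add: npos_def)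
qed

text \<open>Each factor is its lead plus an error of higher degree. Every term in the expansion of
  the difference contains an error, which raises the degree by at least one.\<close>

lemma prod_hK_minus_lead_deg_ge:
  assumes "\<forall>k\<in>set ks. 0 \<le> k"
  shows "prod_list (map (hK c) ks) - prod_list (map (lead c) ks) \<in> deg_ge (npos ks + 1)"
  using assms
proof (induction ks)
  case (Cons k ks)
  let ?h = "prod_list (map (hK c) ks)" and ?l = "prod_list (map (lead c) ks)"
  have e: "hK c k * ?h - lead c k * ?l =
      (hK c k - lead c k) * (?h - ?l) + ((hK c k - lead c k) * ?l + lead c k * (?h - ?l))"
    by (simp add: algebra_simps)
  have d: "hK c k - lead c k \<in> deg_ge (of_bool (k \<noteq> 0) + 1)" "?h - ?l \<in> deg_ge (npos ks + 1)"
    using Cons hK_minus_lead_deg_ge[of k c] by auto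
  have "(hK c k - lead c k) * (?h - ?l) \<in> deg_ge (of_bool (k \<noteq> 0) + npos ks + 1)"
    by (rule deg_ge_mono[OF deg_ge_mult[OF d]]) simp
  moreover have "(hK c k - lead c k) * ?l \<in> deg_ge (of_bool (k \<noteq> 0) + npos ks + 1)"
    by (rule deg_ge_mono[OF deg_ge_mult[OF d(1) prod_lead_deg_ge]]) simp
  moreover have "lead c k * (?h - ?l) \<in> deg_ge (of_bool (k \<noteq> 0) + npos ks + 1)"
    by (rule deg_ge_mono[OF deg_ge_mult[OF lead_deg_ge d(2)]]) simp
  ultimately have "hK c k * ?h - lead c k * ?l \<in> deg_ge (of_bool (k \<noteq> 0) + npos ks + 1)"
    unfolding e by (intro deg_ge_add)
  then show ?case by (simp add: npos_def)
qed simp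

fun mon :: "int list \<Rightarrow> (nat \<Rightarrow>\<^sub>0 nat)" where
  "mon [] = 0"
| "mon (k # ks) = (if k = 0 then 0 else Poly_Mapping.single (nat k - 1) 1) + mon ks"

lemma mwt_mon: "mwt (\<lambda>_. Suc 0) (mon ks) = npos ks"
proof (induction ks)
  case Nil
  then show ?case by (simp add: mwt_def npos_def)
next
  case (Cons k ks)
  then show ?case by (auto simp: mwt_add mwt_single npos_def mwt_def[of _ 0])
qed

lemma prod_lead:
  "prod_list (map (lead c) ks) =
     Poly_Mapping.single (mon ks) (prod_list (map (\<lambda>k. if k = 0 then 1 else c (nat k)) ks))"
proof (induction ks)
  case (Cons k ks)
  then show ?case by (simp add: lead_def avar_def constK_def mult_single)
qed simp

lemma lookup_mon:
  assumes "\<forall>k\<in>set ks. 0 \<le> k"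
  shows "Poly_Mapping.lookup (mon ks) j = count (mset ks) (int j + 1)"
  using assms by (induction ks) (auto simp: lookup_add lookup_single when_def)

text \<open>Zero parts are kept: the length records the number of operators applied.\<close>

definition partitions :: "int list set" where
  "partitions = {\<mu>. sorted \<mu> \<and> (\<forall>k\<in>set \<mu>. 0 \<le> k)}"

text \<open>\<open>mon\<close> determines the multiplicities of the nonzero parts, the common length
  then that of 0, and a sorted list is determined by its multiset.\<close>

lemma mon_inj:
  assumes "\<mu> \<in> partitions" "\<nu> \<in> partitions" "length \<mu> = length \<nu>" "mon \<mu> = mon \<nu>"
  shows "\<mu> = \<nu>"
proof -
  have nonneg: "\<forall>k\<in>set \<mu>. 0 \<le> k" "\<forall>k\<in>set \<nu>. 0 \<le> k" using assms by (auto simp: partitions_def)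
  have neg: "count (mset ks) k = 0" if "k < 0" "\<forall>k\<in>set ks. 0 \<le> k" for k :: int and ks
    using that by (simp add: count_eq_zero_iff) force
  have pos: "count (mset \<mu>) k = count (mset \<nu>) k" if "k \<noteq> 0" for k
  proof (cases "k < 0")
    case True
    then show ?thesis using neg[OF True nonneg(1)] neg[OF True nonneg(2)] by (simp only:)
  next
    case False
    then show ?thesis
      using that lookup_mon[OF nonneg(1), of "nat k - 1"] lookup_mon[OF nonneg(2), of "nat k - 1"] assms(4)
      by (simp add: of_nat_diff)
  qed
  have f: "filter_mset (\<lambda>k. k \<noteq> 0) (mset \<mu>) = filter_mset (\<lambda>k. k \<noteq> 0) (mset \<nu>)"
    by (rule multiset_eqI) (simp add: pos)
  have sz: "size (mset ks) = size (filter_mset (\<lambda>k. k \<noteq> 0) (mset ks)) + count (mset ks) 0" for ks :: "int list"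
    by (induction ks) auto
  have "count (mset \<mu>) 0 = count (mset \<nu>) 0"
    using sz[of \<mu>] sz[of \<nu>] f assms(3) by simp
  then have "count (mset \<mu>) k = count (mset \<nu>) k" for k
    using pos[of k] by (cases "k = 0") simp_all
  then have "mset \<mu> = mset \<nu>" by (rule multiset_eqI)
  then have "sort \<nu> = \<mu>" using assms(1) by (intro properties_for_sort) (simp_all add: partitions_def)
  moreover have "sort \<nu> = \<nu>" using assms(2) by (simp add: partitions_def sort_key_id_if_sorted)
  ultimately show ?thesis by simp
qed

text \<open>Each operator multiplies by e^\<alpha>, that is, adds 2 to the exponent counted in units
  of \<lambda>.\<close>

definition hbasis :: "(nat \<Rightarrow> qfield) \<Rightarrow> int \<Rightarrow> int list \<Rightarrow> fock" where
  "hbasis c n \<mu> = hvec c (n + 2 * int (length \<mu>)) \<mu>"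

text \<open>The functional for \<open>\<mu>\<close> reads the coefficient of
  \<open>mon \<mu>\<close> in the lattice component of \<open>\<mu>\<close>. The component fixes the
  length; below degree \<open>npos \<nu>\<close> the product for \<open>\<nu>\<close> has no terms,
  and in that degree only \<open>mon \<nu>\<close>.\<close>

lemma hbasis_independent:
  assumes c: "\<And>r. r \<ge> 1 \<Longrightarrow> c r \<noteq> 0"
  shows "inj_on (hbasis c n) partitions" and "L.independent (hbasis c n ` partitions)"
proof -
  let ?\<phi> = "\<lambda>\<mu> v. Poly_Mapping.lookup (Poly_Mapping.lookup v (n + 2 * int (length \<mu>))) (mon \<mu>)"
  have add: "?\<phi> \<mu> (v + w) = ?\<phi> \<mu> v + ?\<phi> \<mu> w" for \<mu> v w
    by (simp add: lookup_add)
  have scale: "?\<phi> \<mu> (scaleL x v) = x * ?\<phi> \<mu> v" for \<mu> x v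
    by (simp add: lookup_scaleL lookup_constK_mult)
  let ?C = "\<lambda>\<mu>. prod_list (map (\<lambda>k. if k = 0 then 1 else c (nat k)) \<mu>)"
  have C: "?C \<mu> \<noteq> 0" if "\<mu> \<in> partitions" for \<mu>
  proof -
    have "\<forall>k\<in>set \<mu>. 0 \<le> k" using that by (simp add: partitions_def)
    then show ?thesis by (induction \<mu>) (auto simp: c)
  qed
  have val: "Poly_Mapping.lookup (prod_list (map (hK c) \<nu>)) m = (if m = mon \<nu> then ?C \<nu> else 0)"
    if "\<nu> \<in> partitions" "mwt (\<lambda>_. Suc 0) m \<le> npos \<nu>" for \<nu> m
  proof -
    let ?d = "prod_list (map (hK c) \<nu>) - prod_list (map (lead c) \<nu>)"
    have "?d \<in> deg_ge (npos \<nu> + 1)" using that by (intro prod_hK_minus_lead_deg_ge) (simp add: partitions_def)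
    then have "m \<notin> Poly_Mapping.keys ?d" using that by (auto simp: deg_ge_def)
    then have "Poly_Mapping.lookup ?d m = 0" by (simp add: in_keys_iff)
    then show ?thesis by (auto simp: lookup_minus prod_lead lookup_single when_def)
  qed
  have diag: "?\<phi> \<mu> (hbasis c n \<mu>) \<noteq> 0" if "\<mu> \<in> partitions" for \<mu>
    using val[OF that, of "mon \<mu>"] C[OF that] by (simp add: hbasis_def hvec_def lookup_single mwt_mon)
  have tri: "\<nu> = \<mu> \<or> npos \<nu> < npos \<mu>" if "\<mu> \<in> partitions" "\<nu> \<in> partitions" "?\<phi> \<mu> (hbasis c n \<nu>) \<noteq> 0" for \<mu> \<nu>
  proof (rule ccontr)
    assume n: "\<not> (\<nu> = \<mu> \<or> npos \<nu> < npos \<mu>)"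
    have len: "length \<mu> = length \<nu>"
      using that(3) by (auto simp: hbasis_def hvec_def lookup_single when_def split: if_splits)
    then have "mon \<mu> = mon \<nu>"
      using that val[OF that(2), of "mon \<mu>"] n
      by (auto simp: hbasis_def hvec_def lookup_single mwt_mon split: if_splits)
    then show False using mon_inj[OF that(1,2) len] n by simp
  qed
  show "inj_on (hbasis c n) partitions" "L.independent (hbasis c n ` partitions)"
    using independent_triangular[where \<phi> = ?\<phi> and rank = npos and f = "hbasis c n" and I = partitions,
        OF add scale diag tri] by blast+
qed

section \<open>Monomials in the modes\<close>

text \<open>Equivalent to comparing all partial sums; testing against monotone weights avoids Abel summation.\<close>

definition dominates :: "int list \<Rightarrow> int list \<Rightarrow> bool" where
  "dominates \<mu> ks \<longleftrightarrow> length ks = length \<mu> \<and>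
     (\<forall>w :: nat \<Rightarrow> int. (\<forall>i j. i \<le> j \<longrightarrow> j < length \<mu> \<longrightarrow> w i \<le> w j) \<longrightarrow>
        (\<Sum>i<length \<mu>. w i * \<mu> ! i) \<le> (\<Sum>i<length \<mu>. w i * ks ! i))"

lemma dominates_refl: "dominates \<mu> \<mu>"
  by (simp add: dominates_def)

lemma dominates_length: "dominates \<mu> ks \<Longrightarrow> length ks = length \<mu>"
  by (simp add: dominates_def)

lemma sum_list_eq_sum_nth: "sum_list xs = (\<Sum>i<length xs. xs ! i)"
  by (simp add: sum_list_sum_nth atLeast0LessThan)

text \<open>The constant weights 1 and -1 are both monotone, giving the two inequalities.\<close>

lemma dominates_sum_list:
  assumes "dominates \<mu> ks"
  shows "sum_list ks = sum_list \<mu>"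
proof -
  have w: "(\<Sum>i<length \<mu>. x * \<mu> ! i) \<le> (\<Sum>i<length \<mu>. x * ks ! i)" for x :: int
    using assms by (auto simp: dominates_def)
  show ?thesis
    using w[of 1] w[of "-1"] dominates_length[OF assms] by (simp add: sum_list_eq_sum_nth sum_negf)
qed

text \<open>Weight only moves to the last position, where a monotone \<open>w\<close> is
  largest.\<close>

lemma dominates_append:
  assumes d: "dominates \<mu> ks" and l: "lowered j ks ks'"
  shows "dominates (\<mu> @ [N]) (ks' @ [N + j])"
proof -
  let ?m = "length \<mu>"
  have len: "length ks = ?m" "length ks' = ?m"
    using d l by (auto simp: dominates_def lowered_def dest: list_all2_lengthD)
  have le: "ks' ! i \<le> ks ! i" if "i < ?m" for i
    using l that len by (auto simp: lowered_def list_all2_conv_all_nth)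
  have j: "j = (\<Sum>i<?m. ks ! i - ks' ! i)"
    using l len by (simp add: lowered_def sum_list_eq_sum_nth sum_subtractf)
  have "(\<Sum>i<?m. w i * \<mu> ! i) + w ?m * N \<le> (\<Sum>i<?m. w i * ks' ! i) + w ?m * (N + j)"
    if w: "\<forall>i j. i \<le> j \<longrightarrow> j < Suc ?m \<longrightarrow> w i \<le> w j" for w :: "nat \<Rightarrow> int"
  proof -
    have "(\<Sum>i<?m. w i * \<mu> ! i) \<le> (\<Sum>i<?m. w i * ks ! i)"
      using d w by (auto simp: dominates_def)
    also have "\<dots> = (\<Sum>i<?m. w i * ks' ! i) + (\<Sum>i<?m. w i * (ks ! i - ks' ! i))"
      by (simp add: algebra_simps flip: sum.distrib)
    also have "(\<Sum>i<?m. w i * (ks ! i - ks' ! i)) \<le> (\<Sum>i<?m. w ?m * (ks ! i - ks' ! i))"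
      using w le by (intro sum_mono mult_right_mono) auto
    also have "\<dots> = w ?m * j" by (simp add: j sum_distrib_left)
    finally show ?thesis by (simp add: algebra_simps)
  qed
  then show ?thesis
    using len by (simp add: dominates_def nth_append)
qed

section \<open>The sum of squares as a rank\<close>

definition sqs :: "int list \<Rightarrow> nat" where
  "sqs ks = nat (\<Sum>k\<leftarrow>ks. k\<^sup>2)"

lemma sqs_nth: "int (sqs ks) = (\<Sum>i<length ks. (ks ! i)\<^sup>2)"
  by (simp add: sqs_def sum_list_eq_sum_nth sum_nonneg)

lemma sqs_sort: "sqs (sort ks) = sqs ks"
proof -
  have "sum_mset (image_mset (\<lambda>k. k\<^sup>2) (mset (sort ks))) = sum_mset (image_mset (\<lambda>k. k\<^sup>2) (mset ks))"
    by simp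
  then show ?thesis by (simp only: sqs_def sum_mset_sum_list flip: mset_map)
qed

text \<open>Bounds the rank for a fixed sum of parts, so that ascending induction in
  \<open>span_modes\<close> terminates.\<close>

lemma sqs_le:
  assumes "\<forall>k\<in>set ks. 0 \<le> k"
  shows "sqs ks \<le> nat ((sum_list ks)\<^sup>2)"
proof -
  have "(\<Sum>k\<leftarrow>ks. k\<^sup>2) \<le> (sum_list ks)\<^sup>2 \<and> 0 \<le> sum_list ks"
    using assms
  proof (induction ks)
    case (Cons k ks)
    then have IH: "(\<Sum>k\<leftarrow>ks. k\<^sup>2) \<le> (sum_list ks)\<^sup>2" "0 \<le> sum_list ks" "0 \<le> k" by auto
    have "k\<^sup>2 + (sum_list ks)\<^sup>2 \<le> (k + sum_list ks)\<^sup>2"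
      using mult_nonneg_nonneg[OF IH(3,2)] by (simp add: power2_sum)
    with IH show ?case by simp
  qed simp
  then show ?thesis by (simp add: sqs_def nat_mono)
qed

text \<open>With \<open>ks = \<mu> + d\<close>, the cross term of the square is nonnegative: take \<open>w = \<mu>\<close> in \<open>dominates\<close>.\<close>

lemma dominates_sqs_less:
  assumes d: "dominates \<mu> ks" and s: "sorted \<mu>" and ne: "ks \<noteq> \<mu>"
  shows "sqs \<mu> < sqs ks"
proof -
  let ?m = "length \<mu>"
  have len: "length ks = ?m" using d by (rule dominates_length)
  have "\<forall>i j. i \<le> j \<longrightarrow> j < ?m \<longrightarrow> \<mu> ! i \<le> \<mu> ! j"
    using s by (blast intro: sorted_nth_mono)
  then have 1: "(\<Sum>i<?m. \<mu> ! i * \<mu> ! i) \<le> (\<Sum>i<?m. \<mu> ! i * ks ! i)"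
    using d unfolding dominates_def by blast
  obtain i where i: "i < ?m" "ks ! i \<noteq> \<mu> ! i"
    using ne len by (auto simp: list_eq_iff_nth_eq)
  have "0 < (\<Sum>i<?m. (ks ! i - \<mu> ! i)\<^sup>2)"
    by (rule sum_pos2[of _ i]) (use i in auto)
  also have "\<dots> = (\<Sum>i<?m. (ks ! i)\<^sup>2 - (\<mu> ! i)\<^sup>2 - 2 * (\<mu> ! i * ks ! i) + 2 * (\<mu> ! i * \<mu> ! i))"
    by (simp add: power2_eq_square algebra_simps)
  also have "\<dots> = int (sqs ks) - int (sqs \<mu>) - 2 * (\<Sum>i<?m. \<mu> ! i * ks ! i) + 2 * (\<Sum>i<?m. \<mu> ! i * \<mu> ! i)"
    using len by (simp add: sqs_nth sum.distrib sum_subtractf sum_distrib_left)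
  finally show ?thesis using 1 by linarith
qed

lemma hvec_sort: "hvec c n (sort ks) = hvec c n ks"
proof -
  have "prod_mset (image_mset (hK c) (mset (sort ks))) = prod_mset (image_mset (hK c) (mset ks))"
    by simp
  then show ?thesis by (simp only: hvec_def prod_mset_prod_list flip: mset_map)
qed

lemma hvec_eq_0: "\<not> (\<forall>k\<in>set ks. 0 \<le> k) \<Longrightarrow> hvec c n ks = 0"
proof -
  assume "\<not> (\<forall>k\<in>set ks. 0 \<le> k)"
  then have "prod_list (map (hK c) ks) = 0"
    by (induction ks) (auto simp: hK_neg not_le)
  then show ?thesis by (simp add: hvec_def)
qed

text \<open>Factors commute and a negative part kills the product, so arbitrary lists reduce to
  partitions.\<close>

lemma hvec_cases: "hvec c n ks = 0 \<or> (\<exists>\<nu>\<in>partitions. mset \<nu> = mset ks \<and> hvec c n ks = hvec c n \<nu>)"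
proof (cases "\<forall>k\<in>set ks. 0 \<le> k")
  case True
  then have "sort ks \<in> partitions" by (simp add: partitions_def)
  then show ?thesis using hvec_sort[of c n ks] by (metis mset_sort)
qed (simp add: hvec_eq_0)

text \<open>The \<open>l\<^sub>r\<close> for which \<open>x(l\<^sub>m) \<cdots> x(l\<^sub>1) e\<^sup>n\<^sup>\<lambda>\<close> has leading term \<open>h\<^sub>\<mu> e\<^sup>(\<^sup>n\<^sup>+\<^sup>2\<^sup>m\<^sup>)\<^sup>\<lambda>\<close>.\<close>

definition lseq :: "int \<Rightarrow> int list \<Rightarrow> int list" where
  "lseq n \<mu> = map (\<lambda>r. - (\<mu> ! r) - 1 - n - 2 * int r) [0..<length \<mu>]"

lemma lseq_append: "lseq n (\<mu> @ [a]) = lseq n \<mu> @ [- a - 1 - n - 2 * int (length \<mu>)]"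
  by (simp add: lseq_def nth_append)

definition modes :: "series \<Rightarrow> int \<Rightarrow> int list \<Rightarrow> fock" where
  "modes X n \<mu> = fold (\<lambda>l. X (- l - 1)) (lseq n \<mu>) (expP n)"

lemma modes_append:
  "modes X n (\<mu> @ [a]) = X (a + (n + 2 * int (length \<mu>))) (modes X n \<mu>)"
proof -
  have "- (- a - 1 - n - 2 * int (length \<mu>)) - 1 = a + (n + 2 * int (length \<mu>))" by simp
  then show ?thesis by (simp only: modes_def lseq_append fold_append fold.simps comp_apply id_apply)
qed

text \<open>One part is appended per induction step. The lists \<open>ks\<close> may still be
  unsorted or contain negative entries.\<close>

lemma modes_minus_hvec:
  assumes X: "vertex c X"
  shows "modes X n \<mu> - hvec c (n + 2 * int (length \<mu>)) \<mu> \<in>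
    L.span {hvec c (n + 2 * int (length \<mu>)) ks | ks. dominates \<mu> ks \<and> ks \<noteq> \<mu>}"
proof (induction \<mu> rule: rev_induct)
  case Nil
  then show ?case by (simp add: modes_def lseq_def hvec_def expP_def L.span_zero)
next
  case (snoc a \<mu>)
  have linX: "lin (X m)" for m using X by (simp add: vertex_def)
  let ?n = "n + 2 * int (length \<mu>)"
  let ?T = "L.span {hvec c (?n + 2) ks | ks. dominates (\<mu> @ [a]) ks \<and> ks \<noteq> \<mu> @ [a]}"
  let ?Y = "X (a + ?n)"
  have Y: "?Y (hvec c ?n ks) - hvec c (?n + 2) (ks @ [a]) \<in> raised_span c ?n ks a" for ks
    using X unfolding vertex_def by (metis add_diff_cancel_right')
  have tsub: "raised_span c ?n ks a \<subseteq> ?T" if "dominates \<mu> ks" for ks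
    unfolding raised_span_def
  proof (rule L.span_mono, safe)
    fix ks' and j :: int assume j: "1 \<le> j" "lowered j ks ks'"
    have "dominates (\<mu> @ [a]) (ks' @ [a + j])" by (rule dominates_append[OF that j(2)])
    then show "\<exists>ks. hvec c (?n + 2) (ks' @ [a + j]) = hvec c (?n + 2) ks \<and> dominates (\<mu> @ [a]) ks \<and> ks \<noteq> \<mu> @ [a]"
      using j by (intro exI[of _ "ks' @ [a + j]"]) simp
  qed
  have 1: "?Y (hvec c ?n \<mu>) - hvec c (?n + 2) (\<mu> @ [a]) \<in> ?T"
    using Y tsub[OF dominates_refl] by blast
  \<comment> \<open>An earlier correction differs from \<open>\<mu>\<close> in the old parts and
    still does after appending a; its own new corrections differ in the last entry.\<close>
  have 2: "?Y (modes X n \<mu> - hvec c ?n \<mu>) \<in> ?T"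
  proof (rule lin_span_subset[OF linX snoc L.subspace_span])
    fix b assume "b \<in> {hvec c ?n ks | ks. dominates \<mu> ks \<and> ks \<noteq> \<mu>}"
    then obtain ks where b: "b = hvec c ?n ks" and ks: "dominates \<mu> ks" "ks \<noteq> \<mu>" by blast
    have "dominates (\<mu> @ [a]) (ks @ [a])" using dominates_append[OF ks(1) lowered_refl, of a] by simp
    then have "hvec c (?n + 2) (ks @ [a]) \<in> ?T" using ks by (intro L.span_base) blast
    moreover have "?Y b - hvec c (?n + 2) (ks @ [a]) \<in> ?T" using Y tsub[OF ks(1)] unfolding b by blast
    ultimately have "?Y b - hvec c (?n + 2) (ks @ [a]) + hvec c (?n + 2) (ks @ [a]) \<in> ?T"
      by (intro L.span_add)
    then show "?Y b \<in> ?T" by simp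
  qed
  have "modes X n (\<mu> @ [a]) - hvec c (?n + 2) (\<mu> @ [a]) =
      (?Y (hvec c ?n \<mu>) - hvec c (?n + 2) (\<mu> @ [a])) + ?Y (modes X n \<mu> - hvec c ?n \<mu>)"
    by (simp add: modes_append LL.linear_diff[OF linX])
  also have "\<dots> \<in> ?T" using 1 2 by (rule L.span_add)
  finally show ?case by (simp add: algebra_simps)
qed

text \<open>Sorting a correction changes neither the vector nor \<open>sqs\<close>, and sortedness
  of \<open>\<mu>\<close> makes the rank strictly larger. The equal sums are recorded for the bound
  \<open>sqs_le\<close>.\<close>

lemma modes_minus_hbasis:
  assumes X: "vertex c X" and \<mu>: "\<mu> \<in> partitions"
  shows "modes X n \<mu> - hbasis c n \<mu> \<in>
    L.span (hbasis c n ` {\<nu> \<in> partitions. sum_list \<nu> = sum_list \<mu> \<and> sqs \<mu> < sqs \<nu>})" (is "_ \<in> L.span ?S")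
proof -
  let ?n = "n + 2 * int (length \<mu>)"
  have "L.span {hvec c ?n ks | ks. dominates \<mu> ks \<and> ks \<noteq> \<mu>} \<subseteq> L.span ?S"
  proof (rule L.span_minimal[OF _ L.subspace_span], safe)
    fix ks assume ks: "dominates \<mu> ks" "ks \<noteq> \<mu>"
    show "hvec c ?n ks \<in> L.span ?S"
    proof (cases "hvec c ?n ks = 0")
      case True
      then show ?thesis by (simp add: L.span_zero)
    next
      case False
      then obtain \<nu> where \<nu>: "\<nu> \<in> partitions" "mset \<nu> = mset ks" "hvec c ?n ks = hvec c ?n \<nu>"
        using hvec_cases by blast
      have "length \<nu> = length \<mu>" using dominates_length[OF ks(1)] mset_eq_length[OF \<nu>(2)] by simp
      then have eq: "hvec c ?n ks = hbasis c n \<nu>" using \<nu>(3) by (simp add: hbasis_def)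
      have "sum_list \<nu> = sum_list \<mu>"
        using dominates_sum_list[OF ks(1)] \<nu>(2) by (metis sum_mset_sum_list)
      moreover have "sqs \<nu> = sqs ks" using \<nu>(2) by (metis properties_for_sort sorted_sort mset_sort sqs_sort)
      moreover have "sqs \<mu> < sqs ks" using ks \<mu> by (intro dominates_sqs_less) (auto simp: partitions_def)
      ultimately show ?thesis unfolding eq using \<nu>(1) by (intro L.span_base) auto
    qed
  qed
  then show ?thesis using modes_minus_hvec[OF X, of n \<mu>] by (auto simp: hbasis_def)
qed

lemma independent_modes:
  assumes "vertex c X" and "\<And>r. r \<ge> 1 \<Longrightarrow> c r \<noteq> 0"
  shows "L.independent (modes X n ` partitions)"
proof (rule independent_triangular_change[where b = "hbasis c n" and rank = sqs])
  show "inj_on (hbasis c n) partitions" "L.independent (hbasis c n ` partitions)" using hbasis_independent assms by blast+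
  fix \<mu> assume "\<mu> \<in> partitions"
  from modes_minus_hbasis[OF assms(1) this, of n]
  show "modes X n \<mu> - hbasis c n \<mu> \<in> L.span (hbasis c n ` {\<nu> \<in> partitions. sqs \<mu> < sqs \<nu>})"
    by (rule subsetD[OF L.span_mono, rotated]) auto
qed

text \<open>Inverting the triangular relation needs ranks bounded above: the second inclusion is by
  induction on the gap between \<open>sqs \<mu>\<close> and the squared sum.\<close>

lemma span_modes:
  assumes X: "vertex c X"
  shows "L.span (modes X n ` partitions) = L.span (hbasis c n ` partitions)"
proof (rule L.span_eq[THEN iffD2], intro conjI subsetI)
  fix v assume "v \<in> modes X n ` partitions"
  then obtain \<mu> where \<mu>: "\<mu> \<in> partitions" "v = modes X n \<mu>" by blast
  have "modes X n \<mu> - hbasis c n \<mu> \<in> L.span (hbasis c n ` partitions)"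
    using modes_minus_hbasis[OF X \<mu>(1), of n] by (rule subsetD[OF L.span_mono, rotated]) auto
  from L.span_add[OF this L.span_base[of "hbasis c n \<mu>"]] show "v \<in> L.span (hbasis c n ` partitions)"
    using \<mu> by simp
next
  have "hbasis c n \<mu> \<in> L.span (modes X n ` partitions)" if "\<mu> \<in> partitions" for \<mu>
    using that
  proof (induction "nat ((sum_list \<mu>)\<^sup>2) - sqs \<mu>" arbitrary: \<mu> rule: less_induct)
    case less
    have "L.span (hbasis c n ` {\<nu> \<in> partitions. sum_list \<nu> = sum_list \<mu> \<and> sqs \<mu> < sqs \<nu>}) \<subseteq>
        L.span (modes X n ` partitions)"
    proof (rule L.span_minimal[OF _ L.subspace_span], safe)
      fix \<nu> assume \<nu>: "\<nu> \<in> partitions" "sum_list \<nu> = sum_list \<mu>" "sqs \<mu> < sqs \<nu>"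
      \<comment> \<open>With truncated subtraction, the gap decreases strictly only because
        \<open>sqs \<nu>\<close> stays within the bound.\<close>
      then have "sqs \<nu> \<le> nat ((sum_list \<mu>)\<^sup>2)" using sqs_le[of \<nu>] by (simp add: partitions_def)
      then show "hbasis c n \<nu> \<in> L.span (modes X n ` partitions)"
        using \<nu> by (intro less.hyps) simp_all
    qed
    then have "modes X n \<mu> - hbasis c n \<mu> \<in> L.span (modes X n ` partitions)"
      using modes_minus_hbasis[OF X less.prems, of n] by blast
    moreover have "modes X n \<mu> \<in> L.span (modes X n ` partitions)" using less.prems by (intro L.span_base) simp
    ultimately have "modes X n \<mu> - (modes X n \<mu> - hbasis c n \<mu>) \<in> L.span (modes X n ` partitions)"
      using L.span_diff by blast
    then show ?case by simp
  qed
  then show "v \<in> L.span (modes X n ` partitions)" if "v \<in> hbasis c n ` partitions" for v using that by blast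
qed

lemma hvec_in_span_hbasis:
  "length ks = m \<Longrightarrow> hvec c (n + 2 * int m) ks \<in> L.span (hbasis c n ` partitions)"
proof (cases "hvec c (n + 2 * int m) ks = 0")
  case True
  then show ?thesis by (simp add: L.span_zero)
next
  case False
  assume m: "length ks = m"
  from False obtain \<nu> where \<nu>: "\<nu> \<in> partitions" "mset \<nu> = mset ks"
      "hvec c (n + 2 * int m) ks = hvec c (n + 2 * int m) \<nu>"
    using hvec_cases by blast
  have "length \<nu> = m" using m mset_eq_length[OF \<nu>(2)] by simp
  then have "hvec c (n + 2 * int m) ks = hbasis c n \<nu>" using \<nu>(3) by (simp add: hbasis_def)
  then show ?thesis using \<nu>(1) by (simp add: L.span_base)
qed

text \<open>Holds for every mode, with or without the difference-two condition: a mode yields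
  products with one more factor, in the matching lattice component.\<close>

lemma vertex_span_hbasis:
  assumes X: "vertex c X" and v: "v \<in> L.span (hbasis c n ` partitions)"
  shows "X m v \<in> L.span (hbasis c n ` partitions)"
proof (rule lin_span_subset[OF _ v L.subspace_span])
  show "lin (X m)" using X by (simp add: vertex_def)
  fix b assume "b \<in> hbasis c n ` partitions"
  then obtain \<mu> where b: "b = hbasis c n \<mu>" by blast
  let ?n = "n + 2 * int (length \<mu>)"
  have hvec: "hvec c (?n + 2) ks \<in> L.span (hbasis c n ` partitions)" if "length ks = length \<mu> + 1" for ks
    using hvec_in_span_hbasis[OF that, of c n] by (simp add: algebra_simps)
  have "raised_span c ?n \<mu> (m - ?n) \<subseteq> L.span (hbasis c n ` partitions)"
    unfolding raised_span_def
  proof (rule L.span_minimal[OF _ L.subspace_span], safe)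
    fix ks' j assume "lowered j \<mu> ks'"
    then have "length ks' = length \<mu>" by (auto simp: lowered_def dest: list_all2_lengthD)
    then show "hvec c (?n + 2) (ks' @ [m - ?n + j]) \<in> L.span (hbasis c n ` partitions)" by (intro hvec) simp
  qed
  moreover have "X m b - hvec c (?n + 2) (\<mu> @ [m - ?n]) \<in> raised_span c ?n \<mu> (m - ?n)"
    using X unfolding vertex_def b hbasis_def by blast
  ultimately have "X m b - hvec c (?n + 2) (\<mu> @ [m - ?n]) + hvec c (?n + 2) (\<mu> @ [m - ?n])
      \<in> L.span (hbasis c n ` partitions)"
    by (intro L.span_add hvec) auto
  then show "X m b \<in> L.span (hbasis c n ` partitions)" by simp
qed

section \<open>The Frenkel--Jing operators\<close>

definition c_FJ :: "nat \<Rightarrow> qfield" where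
  "c_FJ r = qh powi (- int r) / qint (int r)"

lemma vertex_xplus: "vertex c_FJ xplus_series"
  using vertex_vop[of c_FJ "\<lambda>r. - c_FJ r"]
  by (simp add: xplus_series_def vop_def vop_right_def c_FJ_def[abs_def])

text \<open>The extra factor is an annihilation exponential, so the same \<open>c_FJ\<close>, hence
  the same \<open>hbasis\<close>, serves both series.\<close>

lemma vertex_xhat: "vertex c_FJ xhat_series"
  unfolding xhat_series_def khat_series_def
  by (rule vertex_ser_mult_exp_annihilation[OF vertex_xplus])

lemma qh_power: "qh ^ n = Fract (monom 1 n) 1"
  by (induction n) (simp_all add: qh_def monom_0 One_fract_def monom_Suc one_pCons)

lemma qh_nonzero: "qh \<noteq> 0"
  by (simp add: qh_def Zero_fract_def eq_fract)

lemma qh_power_eq_1: "qh ^ n = 1 \<longleftrightarrow> n = 0"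
  by (simp add: qh_power One_fract_def eq_fract monom_eq_1_iff)

text \<open>q is not a root of unity: q^s = q^(-s) would give \<open>qh ^ (4 * s) = 1\<close>. This
  is applied to s = r and, for the denominator of \<open>qint\<close>, to s = 1.\<close>

lemma c_FJ_nonzero:
  assumes "r \<ge> 1"
  shows "c_FJ r \<noteq> 0"
proof -
  have ne: "qq ^ s - inverse (qq ^ s) \<noteq> 0" if "s \<ge> 1" for s
  proof
    assume "qq ^ s - inverse (qq ^ s) = 0"
    then have "qq ^ s * qq ^ s = 1" using qh_nonzero by (simp add: qq_def field_simps)
    then have "qh ^ (4 * s) = 1" by (simp add: qq_def power_mult[symmetric] power_add[symmetric])
    then show False using that by (simp add: qh_power_eq_1)
  qed
  have "qint (int r) = (qq ^ r - inverse (qq ^ r)) / (qq - inverse qq)"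
    by (simp add: qint_def power_int_minus)
  then have "qint (int r) \<noteq> 0" using ne[OF assms] ne[of 1] by simp
  then show ?thesis using qh_nonzero by (simp add: c_FJ_def)
qed

text \<open>With r counted from 0, adding 2 r absorbs the gaps of two: the step condition becomes
  weak increase and the initial condition says that the smallest part is nonnegative.\<close>

lemma range_lseq:
  "{ls. (ls \<noteq> [] \<longrightarrow> ls ! 0 \<le> - 1 - n) \<and> (\<forall>r. r + 1 < length ls \<longrightarrow> ls ! (r + 1) \<le> ls ! r - 2)}
     = lseq n ` partitions"
proof (intro equalityI subsetI)
  fix ls assume "ls \<in> {ls. (ls \<noteq> [] \<longrightarrow> ls ! 0 \<le> - 1 - n) \<and>
    (\<forall>r. r + 1 < length ls \<longrightarrow> ls ! (r + 1) \<le> ls ! r - 2)}"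
  then have 0: "ls \<noteq> [] \<Longrightarrow> ls ! 0 \<le> - 1 - n"
    and step: "\<And>r. r + 1 < length ls \<Longrightarrow> ls ! (r + 1) \<le> ls ! r - 2" by auto
  define \<mu> where "\<mu> = map (\<lambda>r. - (ls ! r) - 1 - n - 2 * int r) [0..<length ls]"
  have len: "length \<mu> = length ls" by (simp add: \<mu>_def)
  have nth: "\<mu> ! r = - (ls ! r) - 1 - n - 2 * int r" if "r < length ls" for r
    using that by (simp add: \<mu>_def)
  have "ls = lseq n \<mu>"
    by (rule nth_equalityI) (simp_all add: lseq_def len nth)
  moreover have sorted: "sorted \<mu>"
    unfolding sorted_iff_nth_Suc
  proof (intro allI impI)
    fix r assume "Suc r < length \<mu>"
    then show "\<mu> ! r \<le> \<mu> ! Suc r" using step[of r] by (simp add: len nth)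
  qed
  moreover have "0 \<le> k" if "k \<in> set \<mu>" for k
  proof -
    from that obtain r where r: "r < length \<mu>" "k = \<mu> ! r" by (auto simp: in_set_conv_nth)
    then have "\<mu> ! 0 \<le> \<mu> ! r" using sorted by (intro sorted_nth_mono) simp_all
    moreover have "0 \<le> \<mu> ! 0" using 0 nth[of 0] r len by (cases ls) auto
    ultimately show ?thesis using r by simp
  qed
  ultimately show "ls \<in> lseq n ` partitions" by (auto simp: partitions_def)
next
  fix ls assume "ls \<in> lseq n ` partitions"
  then obtain \<mu> where \<mu>: "\<mu> \<in> partitions" "ls = lseq n \<mu>" by blast
  have nth: "ls ! r = - (\<mu> ! r) - 1 - n - 2 * int r" if "r < length \<mu>" for r
    using that \<mu> by (simp add: lseq_def)
  have len: "length ls = length \<mu>" using \<mu> by (simp add: lseq_def)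
  have "ls ! 0 \<le> - 1 - n" if "ls \<noteq> []"
  proof -
    have "0 < length \<mu>" using that len by auto
    then show ?thesis using nth[of 0] \<mu>(1) nth_mem[of 0 \<mu>] by (auto simp: partitions_def)
  qed
  moreover have "ls ! (r + 1) \<le> ls ! r - 2" if "r + 1 < length ls" for r
    using that len nth[of r] nth[of "r + 1"] \<mu> sorted_nth_mono[of \<mu> r "r + 1"] by (auto simp: partitions_def)
  ultimately show "ls \<in> {ls. (ls \<noteq> [] \<longrightarrow> ls ! 0 \<le> - 1 - n) \<and>
    (\<forall>r. r + 1 < length ls \<longrightarrow> ls ! (r + 1) \<le> ls ! r - 2)}" by auto
qed

lemma Bhat_eq:
  assumes "i \<in> {0, 1}"
  shows "Bhat i = modes xhat_series (int i) ` partitions"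
proof -
  \<comment> \<open>Only for i in {0, 1} does the initial bound of \<open>Bhat\<close> agree with
    \<open>- 1 - int i\<close>.\<close>
  have "int i = of_bool (i = 1)" using assms by auto
  then have "Bhat i = (\<lambda>ls. fold xhat ls (vLambda i)) ` lseq (int i) ` partitions"
    unfolding range_lseq[symmetric] Bhat_def by auto
  also have "\<dots> = modes xhat_series (int i) ` partitions"
    by (simp add: image_image modes_def vLambda_def xhat_def[abs_def])
  finally show ?thesis .
qed

text \<open>The span contains the highest weight vector and is stable under all modes of x^+(z).
  Conversely it is spanned by ordered monomials in these modes, which lie in the principal
  subspace.\<close>

lemma principal_subspace_eq:
  "principal_subspace i = L.span (hbasis c_FJ (int i) ` partitions)" (is "_ = ?V")
proof (intro equalityI subsetI)
  have "A v \<in> ?V" if "A \<in> Uq_nplus" "v \<in> ?V" for A v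
    using that
  proof (induction arbitrary: v)
    case (gen r)
    then show ?case by (simp add: xplus_def vertex_span_hbasis[OF vertex_xplus])
  qed (auto intro: L.span_add L.span_scale)
  moreover have "vLambda i \<in> ?V"
    using hvec_in_span_hbasis[of "[]" 0 c_FJ "int i"] by (simp add: hvec_def vLambda_def expP_def)
  ultimately show "v \<in> ?V" if "v \<in> principal_subspace i" for v
    using that by (auto simp: principal_subspace_def)
next
  let ?W = "principal_subspace i"
  have sub: "L.subspace ?W"
  proof (rule L.subspaceI)
    show "0 \<in> ?W"
      using Uq_nplus.scale[OF Uq_nplus.one, of 0] by (force simp: principal_subspace_def)
    show "v + w \<in> ?W" if "v \<in> ?W" "w \<in> ?W" for v w
      using that Uq_nplus.add by (force simp: principal_subspace_def)
    show "scaleL x v \<in> ?W" if "v \<in> ?W" for x v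
      using that Uq_nplus.scale by (force simp: principal_subspace_def)
  qed
  have "fold xplus ls (vLambda i) \<in> ?W" for ls
  proof (induction ls rule: rev_induct)
    case Nil
    then show ?case using Uq_nplus.one by (force simp: principal_subspace_def)
  next
    case (snoc l ls)
    then obtain A where "A \<in> Uq_nplus" "fold xplus ls (vLambda i) = A (vLambda i)"
      by (auto simp: principal_subspace_def)
    then show ?case using Uq_nplus.mult[OF Uq_nplus.gen, of A l] by (force simp: principal_subspace_def)
  qed
  then have "modes xplus_series (int i) ` partitions \<subseteq> ?W"
    by (auto simp: modes_def vLambda_def xplus_def[abs_def])
  then have "L.span (modes xplus_series (int i) ` partitions) \<subseteq> ?W" using sub by (rule L.span_minimal)
  then show "v \<in> ?W" if "v \<in> ?V" for v
    using that unfolding span_modes[OF vertex_xplus] by blast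
qed

theorem theorem2p8:
  fixes i :: nat
  assumes "i \<in> {0, 1}"
  shows "L.independent (Bhat i) \<and> L.span (Bhat i) = principal_subspace i"
  unfolding Bhat_eq[OF assms] principal_subspace_eq
  using independent_modes[OF vertex_xhat c_FJ_nonzero] span_modes[OF vertex_xhat] by blast

end
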